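(* Let $(S,\cdot,{}^{-1})$ be a finite combinatorial inverse semigroup such that the $6$-element Brandt monoid $(B_2^1,\cdot,{}^{-1})$ satisfies all identities (in the signature $\{\cdot,{}^{-1}\}$) of $(S,\cdot,{}^{-1})$. Then the additively idempotent semiring $(S,+_{\mathrm{nat}},\cdot)$ admits no finite identity basis.
   Context: A semigroup $(S,\cdot)$ is inverse if every $x\in S$ has a unique inverse $x^{-1}$, i.e. a unique element with $xx^{-1}x=x$ and $x^{-1}xx^{-1}=x^{-1}$; inverse semigroups are treated as algebras $(S,\cdot,{}^{-1})$ of type $(2,1)$. A semigroup is combinatorial if all of its subgroups (subsemigroups that are groups) are trivial. The natural partial order on an inverse semigroup is $x\le_{\mathrm{nat}}y \iff x=xx^{-1}y$. If $(S,\le_{\mathrm{nat}})$ is an inf-semilattice (any two elements have an infimum), put $x+_{\mathrm{nat}}y:=\inf\{x,y\}$ with respect to $\le_{\mathrm{nat}}$. It is known that every finite combinatorial inverse semigroup is an inf-semilattice under $\le_{\mathrm{nat}}$, and that then $(S,+_{\mathrm{nat}},\cdot)$ is an additively idempotent semiring. An additively idempotent semiring is an algebra $(S,+,\cdot)$ of type $(2,2)$ such that $(S,+)$ is a commutative idempotent semigroup, $(S,\cdot)$ is a semigroup, and the identities $x(y+z)\approx xy+xz$ and $(y+z)x\approx yx+zx$ hold. The $6$-element Brandt monoid $(B_2^1,\cdot,{}^{-1})$ consists of the six zero-one matrices $\begin{pmatrix}0&0\\0&0\end{pmatrix},\begin{pmatrix}1&0\\0&0\end{pmatrix},\begin{pmatrix}0&1\\0&0\end{pmatrix},\begin{pmatrix}0&0\\1&0\end{pmatrix},\begin{pmatrix}0&0\\0&1\end{pmatrix},\begin{pmatrix}1&0\\0&1\end{pmatrix}$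 under matrix multiplication, with ${}^{-1}$ being transposition. A set $\Sigma$ of identities valid in an algebra $\mathcal A$ is an identity basis for $\mathcal A$ if all identities holding in $\mathcal A$ follow from $\Sigma$. Identity bases of additively idempotent semirings are considered in the signature $\{+,\cdot\}$. *)

theory Defs
  imports "HOL-Analysis.Analysis" "HOL-Algebra.Group" "HOL-Algebra.Lattice"
begin

section \<open>Inverse semigroups\<close>

locale inverse_semigroup =
  fixes S :: "'a set"
    and mul :: "'a \<Rightarrow> 'a \<Rightarrow> 'a"
    and invs :: "'a \<Rightarrow> 'a"
  assumes mul_closed: "x \<in> S \<Longrightarrow> y \<in> S \<Longrightarrow> mul x y \<in> S"
    and mul_assoc: "x \<in> S \<Longrightarrow> y \<in> S \<Longrightarrow> z \<in> S \<Longrightarrow> mul (mul x y) z = mul x (mul y z)"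
    and inv_closed: "x \<in> S \<Longrightarrow> invs x \<in> S"
    and mul_inv_mul: "x \<in> S \<Longrightarrow> mul (mul x (invs x)) x = x"
    and inv_mul_inv: "x \<in> S \<Longrightarrow> mul (mul (invs x) x) (invs x) = invs x"
    and inv_unique:
      "x \<in> S \<Longrightarrow> y \<in> S \<Longrightarrow> mul (mul x y) x = x \<Longrightarrow> mul (mul y x) y = y \<Longrightarrow> y = invs x"

text \<open>Subgroups may have any idempotent as their identity element; the predicate
  \<^const>\<open>group\<close> includes closure of \<open>H\<close> under \<open>mul\<close>.\<close>

definition combinatorial :: "'a set \<Rightarrow> ('a \<Rightarrow> 'a \<Rightarrow> 'a) \<Rightarrow> bool" where
  "combinatorial S mul \<longleftrightarrow>
     (\<forall>H e. H \<subseteq> S \<longrightarrow> group \<lparr>carrier = H, mult = mul, one = e\<rparr> \<longrightarrow> H = {e})"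

definition nat_order :: "'a set \<Rightarrow> ('a \<Rightarrow> 'a \<Rightarrow> 'a) \<Rightarrow> ('a \<Rightarrow> 'a) \<Rightarrow> 'a gorder" where
  "nat_order S mul invs =
     \<lparr>carrier = S, eq = (=), le = (\<lambda>x y. x = mul (mul x (invs x)) y)\<rparr>"

definition nat_add :: "'a set \<Rightarrow> ('a \<Rightarrow> 'a \<Rightarrow> 'a) \<Rightarrow> ('a \<Rightarrow> 'a) \<Rightarrow> 'a \<Rightarrow> 'a \<Rightarrow> 'a" where
  "nat_add S mul invs x y = meet (nat_order S mul invs) x y"

text \<open>Multiplication and inversion on the Brandt monoid are \<^term>\<open>(**)\<close> and
  \<^const>\<open>transpose\<close>.\<close>

definition brandt_monoid :: "(int^2^2) set" where
  "brandt_monoid =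
     {vector [vector [0, 0], vector [0, 0]],
      vector [vector [1, 0], vector [0, 0]],
      vector [vector [0, 1], vector [0, 0]],
      vector [vector [0, 0], vector [1, 0]],
      vector [vector [0, 0], vector [0, 1]],
      vector [vector [1, 0], vector [0, 1]]}"

section \<open>Identities of inverse semigroups\<close>

datatype inv_term = IVar nat | IMul inv_term inv_term | IInv inv_term

primrec inv_eval :: "('a \<Rightarrow> 'a \<Rightarrow> 'a) \<Rightarrow> ('a \<Rightarrow> 'a) \<Rightarrow> (nat \<Rightarrow> 'a) \<Rightarrow> inv_term \<Rightarrow> 'a" where
  "inv_eval mul invs \<phi> (IVar i) = \<phi> i"
| "inv_eval mul invs \<phi> (IMul s t) = mul (inv_eval mul invs \<phi> s) (inv_eval mul invs \<phi> t)"
| "inv_eval mul invs \<phi> (IInv t) = invs (inv_eval mul invs \<phi> t)"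

definition inv_satisfies ::
  "'a set \<Rightarrow> ('a \<Rightarrow> 'a \<Rightarrow> 'a) \<Rightarrow> ('a \<Rightarrow> 'a) \<Rightarrow> inv_term \<times> inv_term \<Rightarrow> bool" where
  "inv_satisfies S mul invs e \<longleftrightarrow>
     (\<forall>\<phi>. range \<phi> \<subseteq> S \<longrightarrow> inv_eval mul invs \<phi> (fst e) = inv_eval mul invs \<phi> (snd e))"

section \<open>Identities in the signature with addition and multiplication\<close>

datatype sr_term = Var nat | Add sr_term sr_term | Mul sr_term sr_term

primrec sr_eval ::
  "('a \<Rightarrow> 'a \<Rightarrow> 'a) \<Rightarrow> ('a \<Rightarrow> 'a \<Rightarrow> 'a) \<Rightarrow> (nat \<Rightarrow> 'a) \<Rightarrow> sr_term \<Rightarrow> 'a" where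
  "sr_eval add mul \<phi> (Var i) = \<phi> i"
| "sr_eval add mul \<phi> (Add s t) = add (sr_eval add mul \<phi> s) (sr_eval add mul \<phi> t)"
| "sr_eval add mul \<phi> (Mul s t) = mul (sr_eval add mul \<phi> s) (sr_eval add mul \<phi> t)"

definition sr_satisfies ::
  "'a set \<Rightarrow> ('a \<Rightarrow> 'a \<Rightarrow> 'a) \<Rightarrow> ('a \<Rightarrow> 'a \<Rightarrow> 'a) \<Rightarrow> sr_term \<times> sr_term \<Rightarrow> bool" where
  "sr_satisfies S add mul e \<longleftrightarrow>
     (\<forall>\<phi>. range \<phi> \<subseteq> S \<longrightarrow> sr_eval add mul \<phi> (fst e) = sr_eval add mul \<phi> (snd e))"

primrec sr_subst :: "(nat \<Rightarrow> sr_term) \<Rightarrow> sr_term \<Rightarrow> sr_term" where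
  "sr_subst \<sigma> (Var i) = \<sigma> i"
| "sr_subst \<sigma> (Add s t) = Add (sr_subst \<sigma> s) (sr_subst \<sigma> t)"
| "sr_subst \<sigma> (Mul s t) = Mul (sr_subst \<sigma> s) (sr_subst \<sigma> t)"

text \<open>``Follows from'' is taken as derivability in equational logic. By
  \<open>follows_sound\<close> and \<open>follows_complete\<close> below this is the same as semantic consequence.
  No axioms of semirings are built in: they have to come from \<open>\<Sigma>\<close>.\<close>

inductive follows :: "(sr_term \<times> sr_term) set \<Rightarrow> sr_term \<Rightarrow> sr_term \<Rightarrow> bool"
  for \<Sigma> :: "(sr_term \<times> sr_term) set" where
  inst: "(s, t) \<in> \<Sigma> \<Longrightarrow> follows \<Sigma> (sr_subst \<sigma> s) (sr_subst \<sigma> t)"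
| refl: "follows \<Sigma> t t"
| sym: "follows \<Sigma> s t \<Longrightarrow> follows \<Sigma> t s"
| trans: "follows \<Sigma> s t \<Longrightarrow> follows \<Sigma> t u \<Longrightarrow> follows \<Sigma> s u"
| add_cong: "follows \<Sigma> s s' \<Longrightarrow> follows \<Sigma> t t' \<Longrightarrow> follows \<Sigma> (Add s t) (Add s' t')"
| mul_cong: "follows \<Sigma> s s' \<Longrightarrow> follows \<Sigma> t t' \<Longrightarrow> follows \<Sigma> (Mul s t) (Mul s' t')"

definition identity_basis ::
  "'a set \<Rightarrow> ('a \<Rightarrow> 'a \<Rightarrow> 'a) \<Rightarrow> ('a \<Rightarrow> 'a \<Rightarrow> 'a) \<Rightarrow> (sr_term \<times> sr_term) set \<Rightarrow> bool" where
  "identity_basis S add mul \<Sigma> \<longleftrightarrow>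
     (\<forall>e\<in>\<Sigma>. sr_satisfies S add mul e) \<and>
     (\<forall>s t. sr_satisfies S add mul (s, t) \<longrightarrow> follows \<Sigma> s t)"

section \<open>Derivability coincides with semantic consequence\<close>

definition closed_under :: "'a set \<Rightarrow> ('a \<Rightarrow> 'a \<Rightarrow> 'a) \<Rightarrow> bool" where
  "closed_under A f \<longleftrightarrow> (\<forall>x\<in>A. \<forall>y\<in>A. f x y \<in> A)"

lemma sr_eval_closed:
  assumes "closed_under A add" "closed_under A mul" "range \<phi> \<subseteq> A"
  shows "sr_eval add mul \<phi> t \<in> A"
  using assms by (induction t) (auto simp: closed_under_def)

lemma sr_eval_subst:
  "sr_eval add mul \<phi> (sr_subst \<sigma> t) = sr_eval add mul (\<lambda>i. sr_eval add mul \<phi> (\<sigma> i)) t"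
  by (induction t) auto

lemma follows_sound:
  assumes "follows \<Sigma> s t"
    and A: "closed_under A add" "closed_under A mul"
    and \<Sigma>: "\<forall>e\<in>\<Sigma>. sr_satisfies A add mul e"
  shows "sr_satisfies A add mul (s, t)"
  using assms(1)
proof (induction rule: follows.induct)
  case (inst s t \<sigma>)
  show ?case unfolding sr_satisfies_def
  proof (intro allI impI, unfold fst_conv snd_conv)
    fix \<phi> :: "nat \<Rightarrow> 'a" assume "range \<phi> \<subseteq> A"
    then have "range (\<lambda>i. sr_eval add mul \<phi> (\<sigma> i)) \<subseteq> A"
      using sr_eval_closed[OF A] by blast
    with \<Sigma> inst show "sr_eval add mul \<phi> (sr_subst \<sigma> s) = sr_eval add mul \<phi> (sr_subst \<sigma> t)"
      unfolding sr_eval_subst sr_satisfies_def by fastforce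
  qed
qed (auto simp: sr_satisfies_def)

lemma follows_complete:
  fixes \<Sigma> :: "(sr_term \<times> sr_term) set"
  assumes cons: "\<And>(A :: sr_term set set) add mul. A \<noteq> {} \<Longrightarrow> closed_under A add \<Longrightarrow>
      closed_under A mul \<Longrightarrow> \<forall>e\<in>\<Sigma>. sr_satisfies A add mul e \<Longrightarrow> sr_satisfies A add mul (s, t)"
  shows "follows \<Sigma> s t"
proof -
  define cl where "cl t = {u. follows \<Sigma> t u}" for t
  define rep where "rep X = (SOME t. X = cl t)" for X
  have cl_eq: "cl u = cl v \<longleftrightarrow> follows \<Sigma> u v" for u v
    unfolding cl_def by (blast intro: follows.refl follows.sym follows.trans)
  have rep: "follows \<Sigma> (rep (cl u)) u" for u
    unfolding rep_def by (rule someI2[of _ u]) (auto simp: cl_eq intro: follows.sym)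
  define add where "add X Y = cl (Add (rep X) (rep Y))" for X Y
  define mul where "mul X Y = cl (Mul (rep X) (rep Y))" for X Y
  have add: "add (cl u) (cl v) = cl (Add u v)" for u v
    unfolding add_def by (simp add: cl_eq follows.add_cong rep)
  have mul: "mul (cl u) (cl v) = cl (Mul u v)" for u v
    unfolding mul_def by (simp add: cl_eq follows.mul_cong rep)
  have ev: "sr_eval add mul (\<lambda>i. cl (\<sigma> i)) u = cl (sr_subst \<sigma> u)" for \<sigma> u
    by (induction u) (simp_all add: add mul)
  have "sr_satisfies (range cl) add mul e" if e: "e \<in> \<Sigma>" for e
    unfolding sr_satisfies_def
  proof (intro allI impI)
    fix \<phi> :: "nat \<Rightarrow> sr_term set" assume "range \<phi> \<subseteq> range cl"
    then have "\<exists>\<sigma>. \<forall>i. \<phi> i = cl (\<sigma> i)"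
      by (intro choice) (auto simp: image_iff subset_iff)
    then obtain \<sigma> where \<phi>: "\<phi> = (\<lambda>i. cl (\<sigma> i))" by auto
    show "sr_eval add mul \<phi> (fst e) = sr_eval add mul \<phi> (snd e)"
      unfolding \<phi> ev cl_eq using follows.inst[of "fst e" "snd e"] e by simp
  qed
  then have "sr_satisfies (range cl) add mul (s, t)"
    by (intro cons) (auto simp: closed_under_def add_def mul_def)
  moreover have "range (\<lambda>i. cl (Var i)) \<subseteq> range cl" by auto
  ultimately have "sr_eval add mul (\<lambda>i. cl (Var i)) s = sr_eval add mul (\<lambda>i. cl (Var i)) t"
    by (simp add: sr_satisfies_def)
  moreover have "sr_subst Var u = u" for u by (induction u) auto
  ultimately show ?thesis by (simp add: ev cl_eq)
qed

end

theory Submission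
  imports Defs
begin

text \<open>
  By the Wagner--Preston representation, \<open>S\<close> is a semigroup of partial injections closed under
  converse, and the natural order becomes inclusion. Since \<open>S\<close> is finite and combinatorial, all
  sufficiently high powers of \<open>x y\<inverse>\<close> restrict \<open>x\<close> to the set where \<open>x\<close> and \<open>y\<close> agree, so
  addition is intersection and is given by the inverse semigroup term \<open>(x y\<inverse>)^k x\<close>, both in \<open>S\<close>
  and in the Brandt monoid. Hence every semiring identity of \<open>S\<close> holds for the six partial
  injections of a two-element set that represent the Brandt monoid.

  Let \<open>w\<close> be the word over \<open>n\<close> letters consisting of two permutations of the alphabet, and
  substitute into it, \<open>h\<close> times, copies of itself over disjoint alphabets. If \<open>h\<close> is at least the
  size of \<open>S\<close>, the value of the resulting word in \<open>S\<close> is idempotent: whenever the rank does not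
  drop, the non-idempotent factors move exactly their own domains, so the two halves of \<open>w\<close>, being
  anagrams, cause the same displacement of a set of points, and this displacement must be zero.

  On the other hand, the word labels a path of length \<open>(2n)^h\<close>, and its letters act as partial
  injections of the vertices, for which the word is not idempotent. Any few of the relations that
  these letters generate admit colourings of the vertices with two colours, turning the relations
  into elements of the Brandt monoid, that separate points; for this the order of the letters in
  \<open>w\<close> has to be sufficiently irregular. So all identities of the Brandt monoid in few variables hold
  for these relations, and a finite basis would force the word to be idempotent there.
\<close>

section \<open>Partial injections and the Wagner--Preston representation\<close>

definition pinj :: "('a \<times> 'b) set \<Rightarrow> bool" where
  "pinj R \<longleftrightarrow> single_valued R \<and> single_valued (R\<inverse>)"

lemma pinj_fun: "pinj R \<Longrightarrow> (x, y) \<in> R \<Longrightarrow> (x, z) \<in> R \<Longrightarrow> y = z"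
  by (auto simp: pinj_def single_valued_def)

lemma pinj_inj: "pinj R \<Longrightarrow> (y, x) \<in> R \<Longrightarrow> (z, x) \<in> R \<Longrightarrow> y = z"
  by (auto simp: pinj_def single_valued_def)

lemma card_Image_pinj:
  assumes "pinj R" "D \<subseteq> Domain R"
  shows "card (R `` D) = card D"
proof -
  obtain f where f: "\<forall>x\<in>D. (x, f x) \<in> R"
    using bchoice[of D "\<lambda>x y. (x, y) \<in> R"] assms(2) by blast
  then have "R `` D = f ` D" using pinj_fun[OF assms(1)] by blast
  moreover have "inj_on f D" using f pinj_inj[OF assms(1)] by (metis inj_onI)
  ultimately show ?thesis by (simp add: card_image)
qed

lemma card_Range_pinj: "pinj R \<Longrightarrow> card (Range R) = card (Domain R)"
  proof -
  assume "pinj R"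
  moreover have "R `` Domain R = Range R" by blast
  ultimately show ?thesis using card_Image_pinj[of R "Domain R"] by simp
qed

context inverse_semigroup
begin

section \<open>Idempotents and inversion in inverse semigroups\<close>

lemma inv_inv: "x \<in> S \<Longrightarrow> invs (invs x) = x"
  using inv_unique[of "invs x" x] by (simp add: inv_closed mul_inv_mul inv_mul_inv)

lemma inv_idem: "e \<in> S \<Longrightarrow> mul e e = e \<Longrightarrow> invs e = e"
  using inv_unique[of e e] by simp

text \<open>For \<open>a = invs (mul e f)\<close> the product \<open>f a e\<close> is again an
  inverse of \<open>e f\<close>, so uniqueness gives \<open>f a e = a\<close>. This makes
  \<open>a\<close> idempotent, hence equal to its own inverse \<open>e f\<close>.\<close>

lemma idem_mul_idem:
  assumes "e \<in> S" "f \<in> S" "mul e e = e" "mul f f = f"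
  shows "mul (mul e f) (mul e f) = mul e f"
proof -
  define a where "a = invs (mul e f)"
  have S[simp]: "e \<in> S" "f \<in> S" "a \<in> S" "mul e f \<in> S"
    using assms by (auto simp: a_def inv_closed mul_closed)
  have e: "mul e (mul e x) = mul e x" and f: "mul f (mul f x) = mul f x" if "x \<in> S" for x
    using assms that by (metis mul_assoc)+
  have a1: "mul e (mul f (mul a (mul e f))) = mul e f"
    using mul_inv_mul[of "mul e f"] by (simp add: a_def[symmetric] mul_assoc mul_closed)
  have a2: "mul a (mul e (mul f a)) = a"
    using inv_mul_inv[of "mul e f"] by (simp add: a_def[symmetric] mul_assoc mul_closed)
  have a2': "mul a (mul e (mul f (mul a x))) = mul a x" if "x \<in> S" for x
    using arg_cong[OF a2, of "\<lambda>y. mul y x"] that by (simp add: mul_assoc mul_closed)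
  have "mul f (mul a e) = invs (mul e f)"
    by (rule inv_unique) (simp_all add: mul_assoc mul_closed e f a1 a2')
  then have fa: "mul f (mul a e) = a" by (simp add: a_def)
  have "mul a a = mul (mul f (mul a e)) (mul f (mul a e))" by (simp only: fa)
  also have "\<dots> = mul f (mul a (mul e (mul f (mul a e))))" by (simp add: mul_assoc mul_closed)
  also have "\<dots> = mul f (mul a e)" by (simp only: a2' S)
  also have "\<dots> = a" by (rule fa)
  finally have "mul a a = a" .
  then have "invs a = a" by (simp add: inv_idem)
  then have "a = mul e f" unfolding a_def by (simp add: inv_inv)
  with \<open>mul a a = a\<close> show ?thesis by simp
qed

text \<open>As both products are idempotent, \<open>f e\<close> is an inverse of \<open>e f\<close>,
  while \<open>e f\<close> is its own inverse.\<close>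

lemma idem_commute:
  assumes "e \<in> S" "f \<in> S" "mul e e = e" "mul f f = f"
  shows "mul e f = mul f e"
proof -
  have ef: "mul (mul e f) (mul e f) = mul e f" and fe: "mul (mul f e) (mul f e) = mul f e"
    using assms by (auto intro: idem_mul_idem)
  have e: "mul e (mul e x) = mul e x" and f: "mul f (mul f x) = mul f x" if "x \<in> S" for x
    using assms that by (metis mul_assoc)+
  have "mul f e = invs (mul e f)"
    using assms ef fe by (intro inv_unique) (simp_all add: mul_assoc mul_closed e f)
  also have "\<dots> = mul e f" using assms ef by (intro inv_idem) (auto simp: mul_closed)
  finally show ?thesis by simp
qed

lemma dom_idem: "x \<in> S \<Longrightarrow> mul (mul x (invs x)) (mul x (invs x)) = mul x (invs x)"
  by (metis mul_assoc mul_inv_mul inv_closed mul_closed)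

lemma ran_idem: "x \<in> S \<Longrightarrow> mul (mul (invs x) x) (mul (invs x) x) = mul (invs x) x"
  by (metis dom_idem inv_inv inv_closed)

lemma dom_ran_commute:
  assumes "x \<in> S" "y \<in> S"
  shows "mul (mul x (invs x)) (mul (invs y) y) = mul (mul (invs y) y) (mul x (invs x))"
  using assms by (intro idem_commute) (auto simp: dom_idem ran_idem inv_closed mul_closed)

text \<open>The candidate passes the two equations because the idempotents
  \<open>mul (invs x) x\<close> and \<open>mul y (invs y)\<close> commute.\<close>

lemma inv_mul:
  assumes "x \<in> S" "y \<in> S"
  shows "invs (mul x y) = mul (invs y) (invs x)"
proof (rule inv_unique[symmetric])
  note C = assms inv_closed mul_closed
  have c: "mul y (mul (invs y) (mul (invs x) (mul x z))) = mul (invs x) (mul x (mul y (mul (invs y) z)))"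
    if "z \<in> S" for z
    using arg_cong[OF dom_ran_commute[OF assms(2,1)], of "\<lambda>a. mul a z"] that
    by (simp add: C mul_assoc)
  have x: "mul x (mul (invs x) (mul x z)) = mul x z" if "z \<in> S" for z
    using mul_inv_mul[OF assms(1)] that C by (metis mul_assoc)
  have y: "mul (invs y) (mul y (mul (invs y) z)) = mul (invs y) z" if "z \<in> S" for z
    using inv_mul_inv[OF assms(2)] that C by (metis mul_assoc)
  have y': "mul y (mul (invs y) y) = y" and x': "mul (invs x) (mul x (invs x)) = invs x"
    using mul_inv_mul[OF assms(2)] inv_mul_inv[OF assms(1)] by (simp_all add: C mul_assoc)
  show "mul (mul (mul x y) (mul (invs y) (invs x))) (mul x y) = mul x y"
    by (simp add: C mul_assoc c x y')
  show "mul (mul (mul (invs y) (invs x)) (mul x y)) (mul (invs y) (invs x)) = mul (invs y) (invs x)"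
    by (simp add: C mul_assoc c[symmetric] y x')
qed (auto simp: assms inv_closed mul_closed)

text \<open>Right translation by \<open>x\<close>, restricted to \<open>S x (invs x)\<close>, where
  right translation by \<open>invs x\<close> undoes it. Acting on the right matches the
  left-to-right order of \<open>O\<close>.\<close>

definition rep :: "'a \<Rightarrow> ('a \<times> 'a) set" where
  "rep x = {(s, mul s x) | s. s \<in> S \<and> mul s (mul x (invs x)) = s}"

lemma rep_iff: "(s, t) \<in> rep x \<longleftrightarrow> s \<in> S \<and> t = mul s x \<and> mul s (mul x (invs x)) = s"
  by (auto simp: rep_def)

lemma rep_subset: "x \<in> S \<Longrightarrow> rep x \<subseteq> S \<times> S"
  by (auto simp: rep_def mul_closed)

lemma rep_converse:
  assumes "x \<in> S"
  shows "rep (invs x) = (rep x)\<inverse>"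
proof -
  \<comment> \<open>Stated for every \<open>y\<close>: applied to \<open>x\<close> and to
    \<open>invs x\<close> it gives both inclusions.\<close>
  have "(rep y)\<inverse> \<subseteq> rep (invs y)" if "y \<in> S" for y
    using that by (auto simp: rep_iff inv_inv inv_closed mul_closed mul_assoc mul_inv_mul[unfolded mul_assoc])
       (metis inv_closed mul_assoc mul_inv_mul)
  from this[OF assms] this[of "invs x"] show ?thesis
    using assms by (auto simp: inv_inv inv_closed)
qed

lemma rep_mul:
  assumes x: "x \<in> S" and y: "y \<in> S"
  shows "rep (mul x y) = rep x O rep y"
proof (intro equalityI subsetI; clarsimp simp: rep_iff)
  note C = x y inv_closed mul_closed
  {
    fix s assume s: "s \<in> S" and eq: "mul s (mul (mul x y) (invs (mul x y))) = s"
    have eq': "mul s (mul x (mul y (mul (invs y) (invs x)))) = s"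
      using eq by (simp add: C inv_mul mul_assoc)
    have "mul s (mul x (invs x)) = mul s (mul x (mul y (mul (invs y) (mul (invs x) (mul x (invs x))))))"
      using arg_cong[OF eq', of "\<lambda>a. mul a (mul x (invs x))"] s by (simp add: C mul_assoc)
    also have "mul (invs x) (mul x (invs x)) = invs x"
      using inv_mul_inv[OF x] by (simp add: C mul_assoc)
    finally have 1: "mul s (mul x (invs x)) = s" by (simp add: eq')
    have "mul s x = mul s (mul x (mul y (mul (invs y) (mul (invs x) x))))"
      using arg_cong[OF eq', of "\<lambda>a. mul a x"] s by (simp add: C mul_assoc)
    also have "mul y (mul (invs y) (mul (invs x) x)) = mul (invs x) (mul x (mul y (invs y)))"
      using dom_ran_commute[OF y x] by (simp add: C mul_assoc)
    also have "mul s (mul x \<dots>) = mul (mul s (mul (mul x (invs x)) x)) (mul y (invs y))"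
      using s by (simp add: C mul_assoc)
    also have "\<dots> = mul (mul s x) (mul y (invs y))" by (simp add: mul_inv_mul x)
    finally have 2: "mul (mul s x) (mul y (invs y)) = mul s x" by simp
    show "(s, mul s (mul x y)) \<in> rep x O rep y"
      using 1 2 s by (auto simp: rep_iff C mul_assoc intro!: relcompI[of _ "mul s x"])
  next
    fix s assume s: "s \<in> S" "mul s (mul x (invs x)) = s" "mul (mul s x) (mul y (invs y)) = mul s x"
    have "mul s (mul (mul x y) (invs (mul x y))) = mul (mul (mul s x) (mul y (invs y))) (invs x)"
      using s(1) by (simp add: C inv_mul mul_assoc)
    also have "\<dots> = s" unfolding s(3) using s by (simp add: C mul_assoc)
    finally show "mul (mul s x) y = mul s (mul x y) \<and> mul s (mul (mul x y) (invs (mul x y))) = s"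
      using s(1) by (simp add: C mul_assoc)
  }
qed

lemma pinj_rep: "x \<in> S \<Longrightarrow> pinj (rep x)"
proof -
  have "single_valued (rep y)" for y by (auto simp: single_valued_def rep_iff)
  then show "x \<in> S \<Longrightarrow> pinj (rep x)" by (auto simp: pinj_def simp flip: rep_converse)
qed

text \<open>From the inclusion, the pair \<open>(mul x (invs x), x)\<close> of \<open>rep x\<close>
  yields the equation. Conversely \<open>x = e y\<close> with \<open>e = mul x (invs x)\<close> puts
  \<open>e\<close> below \<open>mul y (invs y)\<close>, so \<open>rep y\<close> is defined wherever
  \<open>rep x\<close> is and agrees with it there.\<close>

lemma rep_subset_iff:
  assumes x: "x \<in> S" and y: "y \<in> S"
  shows "rep x \<subseteq> rep y \<longleftrightarrow> x = mul (mul x (invs x)) y"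
proof
  assume "rep x \<subseteq> rep y"
  moreover have "(mul x (invs x), x) \<in> rep x"
    using dom_idem[OF x] by (simp add: rep_iff x inv_closed mul_closed mul_inv_mul)
  ultimately have "(mul x (invs x), x) \<in> rep y" by blast
  then show "x = mul (mul x (invs x)) y" unfolding rep_iff by blast
next
  note C = x y inv_closed mul_closed
  define e where "e = mul x (invs x)"
  assume "x = mul (mul x (invs x)) y"
  then have xy: "x = mul e y" by (simp add: e_def)
  have e: "e \<in> S" "mul e e = e" by (auto simp: e_def C dom_idem)
  have e_y: "e = mul e (mul y (invs y))"
  proof -
    have "e = mul (mul e y) (mul (invs y) e)"
      using e inv_mul[OF e(1) y] xy unfolding e_def[symmetric] by (metis e_def inv_idem)
    also have "\<dots> = mul e (mul (mul y (invs y)) e)" using e by (simp add: C mul_assoc)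
    also have "mul (mul y (invs y)) e = mul e (mul y (invs y))"
      using e by (intro idem_commute) (auto simp: C dom_idem)
    also have "mul e \<dots> = mul (mul e e) (mul y (invs y))" using e(1) by (simp add: C mul_assoc)
    finally show ?thesis using e by simp
  qed
  show "rep x \<subseteq> rep y"
  proof (clarsimp simp: rep_iff simp flip: e_def)
    fix s assume s: "s \<in> S" "mul s e = s"
    have "mul s x = mul (mul s e) y" using s(1) e xy by (simp add: C mul_assoc)
    moreover have "mul s (mul y (invs y)) = mul s (mul e (mul y (invs y)))"
      using s e by (metis y inv_closed mul_closed mul_assoc)
    ultimately show "mul s x = mul s y \<and> mul s (mul y (invs y)) = s"
      using s e_y by simp
  qed
qed

text \<open>Each of \<open>x\<close>, \<open>y\<close> is below the other, and commuting idempotents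
  make the natural order antisymmetric.\<close>

lemma rep_inject:
  assumes x: "x \<in> S" and y: "y \<in> S" and eq: "rep x = rep y"
  shows "x = y"
proof -
  note C = x y inv_closed mul_closed
  have 1: "mul (mul x (invs x)) y = x" and 2: "mul (mul y (invs y)) x = y"
    using eq rep_subset_iff[OF x y] rep_subset_iff[OF y x] by auto
  have "y = mul (mul (mul y (invs y)) (mul x (invs x))) y"
    using 1 2 by (simp add: C mul_assoc)
  also have "mul (mul y (invs y)) (mul x (invs x)) = mul (mul x (invs x)) (mul y (invs y))"
    by (intro idem_commute) (auto simp: C dom_idem)
  also have "mul \<dots> y = mul (mul x (invs x)) (mul (mul y (invs y)) y)" by (simp add: C mul_assoc)
  also have "\<dots> = x" using 1 by (simp add: mul_inv_mul y)
  finally show ?thesis by simp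
qed

text \<open>Equal domain and range mean that the idempotents \<open>e\<close> and \<open>f\<close>
  of \<open>x\<close> coincide, so \<open>x\<close> lies in the maximal subgroup \<open>H\<close> at
  \<open>e\<close>. This subgroup is trivial, hence \<open>x = e\<close>, which acts as a partial
  identity.\<close>

lemma rep_combinatorial:
  assumes comb: "combinatorial S mul" and x: "x \<in> S" and eq: "Domain (rep x) = Range (rep x)"
  shows "rep x \<subseteq> Id"
proof -
  note C = x inv_closed mul_closed
  define e where "e = mul x (invs x)"
  define f where "f = mul (invs x) x"
  have e: "e \<in> S" "mul e e = e" and f: "f \<in> S" "mul f f = f"
    by (auto simp: e_def f_def C dom_idem ran_idem)
  have D: "s \<in> Domain (rep x) \<longleftrightarrow> s \<in> S \<and> mul s e = s" for s
    by (auto simp: rep_iff e_def Domain_iff)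
  have R: "s \<in> Range (rep x) \<longleftrightarrow> s \<in> S \<and> mul s f = s" for s
  proof -
    have "s \<in> Range (rep x) \<longleftrightarrow> s \<in> Domain (rep (invs x))" by (simp add: rep_converse x)
    then show ?thesis by (auto simp: rep_iff f_def Domain_iff inv_inv[OF x])
  qed
  have "mul e f = e" "mul f e = f" using D[of e] R[of e] D[of f] R[of f] e f eq by auto
  then have ef: "f = e" using idem_commute[of e f] e f by simp
  define H where "H = {y \<in> S. mul y (invs y) = e \<and> mul (invs y) y = e}"
  have "group \<lparr>carrier = H, mult = mul, one = e\<rparr>"
  proof (rule groupI; simp)
    fix y assume y: "y \<in> H"
    then have yS: "y \<in> S" by (simp add: H_def)
    show "mul e y = y" using y mul_inv_mul[OF yS] by (simp add: H_def)
    show "\<exists>z\<in>H. mul z y = e"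
      using y by (intro bexI[of _ "invs y"]) (auto simp: H_def inv_inv inv_closed)
    fix z assume z: "z \<in> H"
    then have zS: "z \<in> S" by (simp add: H_def)
    have "mul (mul y z) (mul (invs z) (invs y)) = mul y (mul (mul z (invs z)) (invs y))"
      using yS zS by (simp add: inv_closed mul_closed mul_assoc)
    also have "\<dots> = mul (mul y e) (invs y)" using z yS e by (simp add: H_def inv_closed mul_assoc)
    also have "mul y e = mul y (mul (invs y) y)" using y by (simp add: H_def)
    also have "\<dots> = y" using mul_inv_mul[OF yS] yS by (simp add: inv_closed mul_assoc)
    finally have 1: "mul (mul y z) (mul (invs z) (invs y)) = e" using y by (simp add: H_def)
    have "mul (mul (invs z) (invs y)) (mul y z) = mul (invs z) (mul (mul (invs y) y) z)"
      using yS zS by (simp add: inv_closed mul_closed mul_assoc)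
    also have "\<dots> = mul (invs z) (mul e z)" using y by (simp add: H_def)
    also have "mul e z = z" using z mul_inv_mul[OF zS] by (simp add: H_def)
    finally have 2: "mul (mul (invs z) (invs y)) (mul y z) = e" using z by (simp add: H_def)
    show "mul y z \<in> H" using yS zS 1 2 by (simp add: H_def mul_closed inv_mul)
    fix w assume "w \<in> H"
    with yS zS show "mul (mul y z) w = mul y (mul z w)" by (simp add: H_def mul_assoc)
  next
    show "e \<in> H" using e by (simp add: H_def inv_idem)
  qed
  with comb have "H = {e}" unfolding combinatorial_def by (auto simp: H_def)
  moreover have "x \<in> H" using x e_def f_def ef by (simp add: H_def)
  ultimately have "x = e" by simp
  then show ?thesis using e by (auto simp: rep_iff inv_idem)
qed

end

section \<open>Addition as an inverse semigroup term\<close>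

lemma pinj_Id: "pinj Id" by (auto simp: pinj_def single_valued_def)

lemma pinj_relcomp: "pinj R \<Longrightarrow> pinj R' \<Longrightarrow> pinj (R O R')"
  by (simp add: pinj_def converse_relcomp single_valued_relcomp)

lemma pinj_relpow: "pinj (R :: ('a \<times> 'a) set) \<Longrightarrow> pinj (R ^^ n)"
  by (induction n) (auto simp: pinj_Id pinj_relcomp)

lemma antimono_nat_eventually_const:
  fixes f :: "nat \<Rightarrow> nat"
  assumes "antimono f"
  obtains N where "\<And>n. n \<ge> N \<Longrightarrow> f n = f N"
proof -
  define m where "m = (LEAST m. m \<in> range f)"
  have "m \<in> range f" unfolding m_def by (rule LeastI[of _ "f 0"]) simp
  then obtain N where N: "f N = m" by auto
  have "f n = f N" if "n \<ge> N" for n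
  proof (rule antisym)
    show "f n \<le> f N" using assms that by (simp add: antimonoD)
    show "f N \<le> f n" unfolding N m_def by (rule Least_le) simp
  qed
  then show ?thesis by (rule that)
qed

text \<open>The ranges of the powers shrink and become stationary at a set that \<open>R\<close>
  permutes; by cardinality this is also the domain of all large powers. The hypothesis turns these
  powers into partial identities, and comparing two consecutive ones shows that \<open>R\<close>
  fixes their points.\<close>

lemma eventually_relpow_subset:
  assumes R: "pinj R" "finite R"
    and pow: "\<And>n. Domain (R ^^ Suc n) = Range (R ^^ Suc n) \<Longrightarrow> R ^^ Suc n \<subseteq> Id"
  shows "eventually (\<lambda>n. R ^^ Suc n \<subseteq> Id \<inter> R) sequentially"
proof -
  define A where "A n = Range (R ^^ Suc n)" for n
  have A_Suc: "A (Suc n) = R `` A n" for n unfolding A_def by auto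
  have A_ran: "A n \<subseteq> Range R" for n unfolding A_def by auto
  then have finA: "finite (A n)" for n using R(2) by (meson finite_Range finite_subset)
  have dec: "A (Suc n) \<subseteq> A n" for n
  proof (induction n)
    case 0
    then show ?case by (auto simp: A_def)
  next
    case (Suc n)
    then show ?case unfolding A_Suc[of "Suc n"] A_Suc[of n] by blast
  qed
  then have antiA: "antimono A" by (rule decseq_SucI)
  then have "antimono (\<lambda>n. card (A n))"
    using finA by (auto intro!: antimonoI card_mono dest: antimonoD)
  then obtain N where N: "\<And>n. n \<ge> N \<Longrightarrow> card (A n) = card (A N)"
    by (rule antimono_nat_eventually_const) blast
  have AN: "A n = A N" if "n \<ge> N" for n
    using card_subset_eq[OF finA antimonoD[OF antiA that] N[OF that]] .
  have RA: "R `` A N = A N" using A_Suc[of N] AN[of "Suc N"] by simp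
  have "card (A N) = card (A N \<inter> Domain R)"
  proof -
    have "R `` (A N \<inter> Domain R) = A N" using RA by blast
    then show ?thesis using card_Image_pinj[OF R(1), of "A N \<inter> Domain R"] by simp
  qed
  then have "A N \<inter> Domain R = A N" using finA by (intro card_subset_eq) auto
  then have AD: "A N \<subseteq> Domain R" by blast
  have dom: "A N \<subseteq> Domain (R ^^ n)" for n
  proof
    fix x assume "x \<in> A N"
    then have "\<exists>y\<in>A N. (x, y) \<in> R ^^ n"
    proof (induction n)
      case (Suc n)
      then obtain y where y: "y \<in> A N" "(x, y) \<in> R ^^ n" by blast
      with AD obtain z where "(y, z) \<in> R" by blast
      with y RA show ?case by auto
    qed auto
    then show "x \<in> Domain (R ^^ n)" by blast
  qed
  have DA: "Domain (R ^^ Suc n) = A N" if "n \<ge> N" for n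
  proof (rule card_subset_eq[symmetric])
    have "Domain (R ^^ Suc n) \<subseteq> Domain R"
      by (blast dest: relpow_Suc_D2)
    then show "finite (Domain (R ^^ Suc n))" using R(2) by (meson finite_Domain finite_subset)
    show "card (A N) = card (Domain (R ^^ Suc n))"
      using card_Range_pinj[OF pinj_relpow[OF R(1), of "Suc n"]] AN[OF that]
      by (simp only: A_def)
  qed (rule dom)
  have Id: "R ^^ Suc n \<subseteq> Id" if "n \<ge> N" for n
    using pow[of n] DA[OF that] AN[OF that] by (simp only: A_def simp_thms)
  have "R ^^ Suc n \<subseteq> Id \<inter> R" if n: "n \<ge> N" for n
  proof
    fix a assume a: "a \<in> R ^^ Suc n"
    obtain x where x: "a = (x, x)" using a Id[OF n] by auto
    have "x \<in> Domain (R ^^ Suc (Suc n))" using DA[OF n] DA[of "Suc n"] n a x by auto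
    then obtain y where y: "(x, y) \<in> R ^^ Suc (Suc n)" by blast
    moreover have "x = y" using Id[of "Suc n"] n y by auto
    ultimately obtain z where z: "(x, z) \<in> R ^^ Suc n" "(z, x) \<in> R" by auto
    then have "x = z" using Id[OF n] by auto
    with z x Id[OF n] a show "a \<in> Id \<inter> R" by auto
  qed
  then show ?thesis by (auto simp: eventually_sequentially)
qed

text \<open>\<open>x O y\<inverse>\<close> fixes exactly the points at which \<open>x\<close> and
  \<open>y\<close> are both defined and agree, and all its powers fix them too. A power as in
  \<open>sub\<close> is therefore the identity on these points.\<close>

lemma Int_eq_relpow:
  assumes "pinj x" "pinj y" and sub: "(x O y\<inverse>) ^^ Suc n \<subseteq> Id \<inter> (x O y\<inverse>)"
  shows "(x O y\<inverse>) ^^ Suc n O x = x \<inter> y"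
proof (intro equalityI subsetI)
  fix p assume "p \<in> (x O y\<inverse>) ^^ Suc n O x"
  then obtain a b c where p: "p = (a, c)" "(a, b) \<in> (x O y\<inverse>) ^^ Suc n" "(b, c) \<in> x" by blast
  with sub have "a = b" "(a, b) \<in> x O y\<inverse>" by blast+
  then obtain d where "(a, d) \<in> x" "(a, d) \<in> y" by blast
  with p \<open>a = b\<close> show "p \<in> x \<inter> y" using pinj_fun[OF assms(1)] by blast
next
  fix p assume "p \<in> x \<inter> y"
  then obtain a c where p: "p = (a, c)" "(a, c) \<in> x" "(a, c) \<in> y" by (cases p) auto
  have "(a, a) \<in> (x O y\<inverse>) ^^ k" for k
    using p by (induction k) auto
  with p show "p \<in> (x O y\<inverse>) ^^ Suc n O x" by blast
qed

text \<open>The exponent is \<open>n + 1\<close>, since terms have no unit.\<close>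

primrec inv_pow :: "inv_term \<Rightarrow> nat \<Rightarrow> inv_term" where
  "inv_pow t 0 = t"
| "inv_pow t (Suc n) = IMul (inv_pow t n) t"

primrec inv_of_sr :: "nat \<Rightarrow> sr_term \<Rightarrow> inv_term" where
  "inv_of_sr n (Var i) = IVar i"
| "inv_of_sr n (Add s t) =
    IMul (inv_pow (IMul (inv_of_sr n s) (IInv (inv_of_sr n t))) n) (inv_of_sr n s)"
| "inv_of_sr n (Mul s t) = IMul (inv_of_sr n s) (inv_of_sr n t)"

text \<open>Common setting for \<open>S\<close> and for the Brandt monoid. The same \<open>n\<close>
  must serve both, because one term has to express intersection in both.\<close>

locale pinj_representation =
  fixes M :: "'a set" and mul :: "'a \<Rightarrow> 'a \<Rightarrow> 'a" and invs :: "'a \<Rightarrow> 'a"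
    and r :: "'a \<Rightarrow> ('b \<times> 'b) set" and n :: nat
  assumes mulM: "x \<in> M \<Longrightarrow> y \<in> M \<Longrightarrow> mul x y \<in> M"
    and invM: "x \<in> M \<Longrightarrow> invs x \<in> M"
    and r_mul: "x \<in> M \<Longrightarrow> y \<in> M \<Longrightarrow> r (mul x y) = r x O r y"
    and r_inv: "x \<in> M \<Longrightarrow> r (invs x) = (r x)\<inverse>"
    and r_pinj: "x \<in> M \<Longrightarrow> pinj (r x)"
    and r_pow: "x \<in> M \<Longrightarrow> r x ^^ Suc n \<subseteq> Id \<inter> r x"
begin

lemma eval_inv_pow:
  assumes "inv_eval mul invs \<phi> t \<in> M"
  shows "inv_eval mul invs \<phi> (inv_pow t k) \<in> M \<and>
    r (inv_eval mul invs \<phi> (inv_pow t k)) = r (inv_eval mul invs \<phi> t) ^^ Suc k"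
  by (induction k) (use assms in \<open>auto simp: mulM r_mul\<close>)

lemma eval_inv_of_sr:
  assumes "range \<phi> \<subseteq> M"
  shows "inv_eval mul invs \<phi> (inv_of_sr n t) \<in> M \<and>
    r (inv_eval mul invs \<phi> (inv_of_sr n t)) = sr_eval (\<inter>) (O) (r \<circ> \<phi>) t"
proof (induction t)
  case (Add s t)
  let ?s = "inv_eval mul invs \<phi> (inv_of_sr n s)" and ?t = "inv_eval mul invs \<phi> (inv_of_sr n t)"
  let ?u = "IMul (inv_of_sr n s) (IInv (inv_of_sr n t))"
  have st: "?s \<in> M" "?t \<in> M" using Add by auto
  then have u: "inv_eval mul invs \<phi> ?u \<in> M" and ru: "r (inv_eval mul invs \<phi> ?u) = r ?s O (r ?t)\<inverse>"
    by (auto simp: mulM invM r_mul r_inv)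
  have pow: "inv_eval mul invs \<phi> (inv_pow ?u n) \<in> M"
    "r (inv_eval mul invs \<phi> (inv_pow ?u n)) = (r ?s O (r ?t)\<inverse>) ^^ Suc n"
    using eval_inv_pow[OF u, of n] by (simp_all only: ru)
  have "r (inv_eval mul invs \<phi> (inv_of_sr n (Add s t))) = (r ?s O (r ?t)\<inverse>) ^^ Suc n O r ?s"
    by (simp only: inv_of_sr.simps inv_eval.simps(2) r_mul[OF pow(1) st(1)] pow(2))
  also have "\<dots> = r ?s \<inter> r ?t"
    using r_pow[OF u] st by (intro Int_eq_relpow r_pinj) (simp_all only: ru)
  finally show ?case using pow(1) st Add by (simp add: mulM)
qed (use assms in \<open>auto simp: mulM r_mul\<close>)

end

text \<open>All partial injections of a two-element set apart from the transposition of the two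
  points.\<close>

inductive_set brandt_rels :: "(bool \<times> bool) set set" where
  empty: "{} \<in> brandt_rels"
| single: "{(a, b)} \<in> brandt_rels"
| Id: "Id \<in> brandt_rels"

section \<open>Zero-one matrices as relations on two points\<close>

definition rel_of_matrix :: "int^2^2 \<Rightarrow> (bool \<times> bool) set" where
  "rel_of_matrix A = {(a, b). A $ (if a then 1 else 2) $ (if b then 1 else 2) = 1}"

lemma matrix_2_eq_iff:
  fixes A B :: "'a^2^2"
  shows "A = B \<longleftrightarrow> A $ 1 $ 1 = B $ 1 $ 1 \<and> A $ 1 $ 2 = B $ 1 $ 2 \<and> A $ 2 $ 1 = B $ 2 $ 1 \<and> A $ 2 $ 2 = B $ 2 $ 2"
  by (auto simp: vec_eq_iff forall_2)

lemma brandt_monoid_iff: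
  "A \<in> brandt_monoid \<longleftrightarrow> (A $ 1 $ 1, A $ 1 $ 2, A $ 2 $ 1, A $ 2 $ 2) \<in>
    {(0,0,0,0), (1,0,0,0), (0,1,0,0), (0,0,1,0), (0,0,0,1), (1,0,0,1)}"
  by (simp add: brandt_monoid_def matrix_2_eq_iff)

lemma brandt_rels_subset_image: "brandt_rels \<subseteq> rel_of_matrix ` brandt_monoid"
proof
  fix R assume "R \<in> brandt_rels"
  define e where "e a b = (if (a, b) \<in> R then 1 else 0 :: int)" for a b
  define A :: "int^2^2" where
    "A = vector [vector [e True True, e True False], vector [e False True, e False False]]"
  have "(a, b) \<in> rel_of_matrix A \<longleftrightarrow> (a, b) \<in> R" for a b
    by (cases a; cases b) (simp_all add: rel_of_matrix_def A_def e_def)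
  then have "rel_of_matrix A = R" by auto
  moreover have "A \<in> brandt_monoid"
    using \<open>R \<in> brandt_rels\<close> by cases (auto simp: brandt_monoid_iff A_def e_def)
  ultimately show "R \<in> rel_of_matrix ` brandt_monoid" by blast
qed

lemma rel_of_matrix_eq_Un:
  "rel_of_matrix A = (if A $ 1 $ 1 = 1 then {(True, True)} else {}) \<union> (if A $ 1 $ 2 = 1 then {(True, False)} else {}) \<union>
    (if A $ 2 $ 1 = 1 then {(False, True)} else {}) \<union> (if A $ 2 $ 2 = 1 then {(False, False)} else {})"
proof -
  have "(a, b) \<in> rel_of_matrix A \<longleftrightarrow> A $ (if a then 1 else 2) $ (if b then 1 else 2) = 1" for a b
    by (simp add: rel_of_matrix_def)
  then show ?thesis by (auto split: if_splits)
qed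

lemma Id_bool_eq: "Id = {(False, False), (True, True)}"
  by auto

lemma rel_of_matrix_brandt:
  assumes "A \<in> brandt_monoid"
  shows "rel_of_matrix A \<in> brandt_rels"
  using assms unfolding brandt_monoid_iff
  by (auto simp: rel_of_matrix_eq_Un intro: brandt_rels.empty brandt_rels.single brandt_rels.Id[unfolded Id_bool_eq])

lemma brandt_monoid_mult:
  assumes "A \<in> brandt_monoid" "B \<in> brandt_monoid"
  shows "A ** B \<in> brandt_monoid"
  using assms unfolding brandt_monoid_def
  by (elim insertE emptyE; hypsubst) (simp_all add: matrix_2_eq_iff matrix_matrix_mult_def sum_2)

lemma brandt_monoid_transpose: "A \<in> brandt_monoid \<Longrightarrow> transpose A \<in> brandt_monoid"
  by (auto simp: brandt_monoid_iff transpose_def)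

lemma rel_of_matrix_mult:
  assumes "A \<in> brandt_monoid" "B \<in> brandt_monoid"
  shows "rel_of_matrix (A ** B) = rel_of_matrix A O rel_of_matrix B"
proof -
  have "(a, b) \<in> rel_of_matrix (A ** B) \<longleftrightarrow> (\<exists>c. (a, c) \<in> rel_of_matrix A \<and> (c, b) \<in> rel_of_matrix B)" for a b
    using assms unfolding brandt_monoid_def
    by (elim insertE emptyE; hypsubst)
       (cases a; cases b; simp add: rel_of_matrix_def ex_bool_eq matrix_matrix_mult_def sum_2)+
  then show ?thesis by (auto simp: relcomp_unfold)
qed

lemma pinj_brandt_rels: "R \<in> brandt_rels \<Longrightarrow> pinj R"
  by (auto elim!: brandt_rels.cases simp: pinj_def single_valued_def)

text \<open>Powers start at two: \<open>{(a, b)}\<close> with \<open>a \<noteq> b\<close> is not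
  below \<open>Id\<close>, but its square is empty. Hence the successor exponent in the
  representation of the Brandt monoid.\<close>

lemma brandt_rels_relpow:
  assumes "R \<in> brandt_rels"
  shows "R ^^ Suc (Suc n) \<subseteq> Id \<inter> R"
proof -
  have "R O R \<subseteq> Id \<inter> R" "R O R O R \<subseteq> R O R" using assms by (auto elim!: brandt_rels.cases)
  then show ?thesis by (induction n) auto
qed

lemma pinj_representation_brandt: "pinj_representation brandt_monoid (**) transpose rel_of_matrix (Suc n)"
proof
  fix A assume "A \<in> brandt_monoid"
  then have "rel_of_matrix A \<in> brandt_rels" by (rule rel_of_matrix_brandt)
  then show "pinj (rel_of_matrix A)" "rel_of_matrix A ^^ Suc (Suc n) \<subseteq> Id \<inter> rel_of_matrix A"
    by (rule pinj_brandt_rels, rule brandt_rels_relpow)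
next
  show "rel_of_matrix (transpose A) = (rel_of_matrix A)\<inverse>" for A
    by (auto simp: rel_of_matrix_def transpose_def)
qed (auto simp: brandt_monoid_mult brandt_monoid_transpose rel_of_matrix_mult)

lemma brandt_rels_satisfies:
  assumes "inv_satisfies brandt_monoid (**) transpose (inv_of_sr (Suc n) s, inv_of_sr (Suc n) t)"
  shows "sr_satisfies brandt_rels (\<inter>) (O) (s, t)"
  unfolding sr_satisfies_def
proof (intro allI impI, unfold fst_conv snd_conv)
  interpret pinj_representation brandt_monoid "(**)" transpose rel_of_matrix "Suc n" by (rule pinj_representation_brandt)
  fix \<psi> :: "nat \<Rightarrow> (bool \<times> bool) set" assume "range \<psi> \<subseteq> brandt_rels"
  then have "\<forall>i. \<exists>A\<in>brandt_monoid. \<psi> i = rel_of_matrix A" using brandt_rels_subset_image by blast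
  then obtain \<phi> where "\<And>i. \<phi> i \<in> brandt_monoid" "\<And>i. \<psi> i = rel_of_matrix (\<phi> i)" by metis
  then have \<phi>: "range \<phi> \<subseteq> brandt_monoid" "\<psi> = rel_of_matrix \<circ> \<phi>" by auto
  with assms show "sr_eval (\<inter>) (O) \<psi> s = sr_eval (\<inter>) (O) \<psi> t"
    using eval_inv_of_sr[OF \<phi>(1)] by (simp add: inv_satisfies_def) metis
qed

section \<open>Nested anagrams\<close>

lemma Image_subset_Domain:
  assumes "pinj R" "D \<subseteq> Domain (R O R')"
  shows "R `` D \<subseteq> Domain R'"
proof
  fix y assume "y \<in> R `` D"
  then obtain x where x: "x \<in> D" "(x, y) \<in> R" by blast
  then obtain z y' where "(x, y') \<in> R" "(y', z) \<in> R'" using assms(2) by blast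
  moreover have "y' = y" using pinj_fun[OF assms(1)] x calculation(1) by blast
  ultimately show "y \<in> Domain R'" by blast
qed

text \<open>The value at \<open>[]\<close> is an arbitrary default, as terms have no unit.\<close>

fun mulprod :: "sr_term list \<Rightarrow> sr_term" where
  "mulprod [] = Var 0"
| "mulprod [t] = t"
| "mulprod (t # u # ts) = Mul t (mulprod (u # ts))"

definition relprod :: "('a \<times> 'a) set list \<Rightarrow> ('a \<times> 'a) set" where
  "relprod Rs = foldr (O) Rs Id"

lemma relprod_simps [simp]: "relprod [] = Id" "relprod (R # Rs) = R O relprod Rs"
  by (simp_all add: relprod_def)

lemma relprod_append: "relprod (Rs @ Rs') = relprod Rs O relprod Rs'"
  by (induction Rs) (simp_all add: O_assoc)

lemma eval_mulprod:
  "ts \<noteq> [] \<Longrightarrow> sr_eval add (O) \<phi> (mulprod ts) = relprod (map (sr_eval add (O) \<phi>) ts)"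
  by (induction ts rule: mulprod.induct) auto

text \<open>The copies of the lower word have pairwise disjoint sets of letters, the letter \<open>x\<close> of the
  \<open>i\<close>-th copy being \<open>n * x + i\<close>.\<close>

primrec nested_word :: "nat \<Rightarrow> (nat \<Rightarrow> nat) \<Rightarrow> nat \<Rightarrow> sr_term" where
  "nested_word n v 0 = Var 0"
| "nested_word n v (Suc h) =
    mulprod (map (\<lambda>t. sr_subst (\<lambda>x. Var (n * x + v t)) (nested_word n v h)) [0..<2 * n])"

lemma eval_nested_word_Suc:
  assumes "n > 0"
  shows "sr_eval add (O) \<phi> (nested_word n v (Suc h)) =
    relprod (map (\<lambda>t. sr_eval add (O) (\<lambda>x. \<phi> (n * x + v t)) (nested_word n v h)) [0..<2 * n])"
  using assms by (simp add: eval_mulprod sr_eval_subst comp_def)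

text \<open>If every factor either fixes its whole domain pointwise or has a domain of the size of \<open>D\<close>,
  then a factor of the second kind moves exactly its own domain onto its range; so the total
  displacement of \<open>D\<close> does not depend on the order of the factors.\<close>

definition displacement :: "('a \<times> 'a) set \<Rightarrow> 'a set \<Rightarrow> int" where
  "displacement R Y = (if R \<subseteq> Id then 0 else of_bool (Range R = Y) - of_bool (Domain R = Y))"

lemma relprod_displacement:
  assumes "\<And>R. R \<in> set Rs \<Longrightarrow> pinj R \<and> finite R \<and> (R \<subseteq> Id \<or> card (Domain R) = card D)"
    and "D \<subseteq> Domain (relprod Rs)"
  shows "of_bool (relprod Rs `` D = Y) - of_bool (D = Y) = (\<Sum>R\<leftarrow>Rs. displacement R Y)"
  using assms
proof (induction Rs arbitrary: D)
  case (Cons R Rs)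
  have R: "pinj R" "finite R" "R \<subseteq> Id \<or> card (Domain R) = card D" using Cons.prems(1)[of R] by auto
  have D: "D \<subseteq> Domain R" using Cons.prems(2) by auto
  have "card (R `` D) = card D" by (rule card_Image_pinj[OF R(1) D])
  moreover have "R `` D \<subseteq> Domain (relprod Rs)"
    using Cons.prems(2) by (intro Image_subset_Domain[OF R(1)]) simp
  ultimately have "of_bool (relprod Rs `` (R `` D) = Y) - of_bool (R `` D = Y) =
      (\<Sum>R\<leftarrow>Rs. displacement R Y)"
    using Cons.prems(1) by (intro Cons.IH) auto
  moreover have "of_bool (R `` D = Y) - of_bool (D = Y) = displacement R Y"
  proof (cases "R \<subseteq> Id")
    case True
    with D have "R `` D = D" by blast
    with True show ?thesis by (simp add: displacement_def)
  next
    case False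
    with R D have "D = Domain R" by (intro card_subset_eq) (auto simp: finite_Domain)
    moreover have "R `` Domain R = Range R" by blast
    ultimately show ?thesis using False by (simp add: displacement_def)
  qed
  ultimately show ?case by (simp add: relcomp_Image)
qed (simp add: displacement_def)

section \<open>The rank argument in an aperiodic semigroup of partial injections\<close>

locale aperiodic_rels =
  fixes X :: "'a set" and T :: "('a \<times> 'a) set set"
  assumes finX: "finite X"
    and T_subset: "R \<in> T \<Longrightarrow> R \<subseteq> X \<times> X"
    and T_pinj: "R \<in> T \<Longrightarrow> pinj R"
    and T_relcomp: "R \<in> T \<Longrightarrow> R' \<in> T \<Longrightarrow> R O R' \<in> T"
    and T_aperiodic: "R \<in> T \<Longrightarrow> Domain R = Range R \<Longrightarrow> R \<subseteq> Id"
begin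

lemma T_finite: "R \<in> T \<Longrightarrow> finite R"
  using T_subset finX by (meson finite_SigmaI finite_subset)

lemma relprod_in_T: "set Rs \<subseteq> T \<Longrightarrow> Rs \<noteq> [] \<Longrightarrow> relprod Rs \<in> T"
proof (induction Rs)
  case (Cons R Rs)
  then show ?case by (cases "Rs = []") (auto intro: T_relcomp)
qed simp

lemma card_Domain_relprod_le:
  assumes "set Rs \<subseteq> T" "R \<in> set Rs"
  shows "card (Domain (relprod Rs)) \<le> card (Domain R)"
  using assms
proof (induction Rs)
  case (Cons Q Rs)
  have Q: "Q \<in> T" using Cons.prems by simp
  show ?case
  proof (cases "R = Q")
    case True
    then show ?thesis using T_finite[OF Q] by (auto intro!: card_mono simp: finite_Domain)
  next
    case False
    then have R: "R \<in> set Rs" using Cons.prems by simp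
    then have P: "relprod Rs \<in> T" using Cons.prems by (intro relprod_in_T) auto
    have QP: "Q O relprod Rs \<in> T" by (intro T_relcomp Q P)
    have "card (Domain (Q O relprod Rs)) = card (Range (Q O relprod Rs))"
      by (simp add: card_Range_pinj T_pinj QP)
    also have "\<dots> \<le> card (Range (relprod Rs))"
      using T_finite[OF P] by (intro card_mono) (auto simp: finite_Range)
    also have "\<dots> = card (Domain (relprod Rs))" by (simp add: card_Range_pinj T_pinj P)
    also have "\<dots> \<le> card (Domain R)" using Cons R by simp
    finally show ?thesis by simp
  qed
qed simp

text \<open>\<open>D0\<close>, \<open>D1\<close>, \<open>D2\<close> are the domain of the product
  and its images after one and after both halves. Anagrams have equal sums of displacements, which
  forces the three sets to coincide; the product then maps its domain onto itself and aperiodicity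
  applies.\<close>

lemma anagram_product_idem:
  assumes T: "set Rs \<subseteq> T" "set Rs' \<subseteq> T" "Rs \<noteq> []" and mset: "mset Rs = mset Rs'"
    and rank: "\<And>R. R \<in> set Rs \<Longrightarrow> R \<subseteq> Id \<or> card (Domain R) = card (Domain (relprod (Rs @ Rs')))"
  shows "relprod (Rs @ Rs') \<subseteq> Id"
proof -
  define w where "w = relprod (Rs @ Rs')"
  have w: "w \<in> T" unfolding w_def using T by (intro relprod_in_T) auto
  define D0 where "D0 = Domain w"
  define D1 where "D1 = relprod Rs `` D0"
  define D2 where "D2 = relprod Rs' `` D1"
  have set_eq: "set Rs' = set Rs" using mset by (metis set_mset_mset)
  have rel: "relprod Rs \<in> T" using T by (intro relprod_in_T) auto
  have w_eq: "w = relprod Rs O relprod Rs'" by (simp add: w_def relprod_append)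
  have D0: "D0 \<subseteq> Domain (relprod Rs)" by (auto simp: D0_def w_eq)
  have D1: "D1 \<subseteq> Domain (relprod Rs')"
    unfolding D1_def D0_def w_eq by (rule Image_subset_Domain[OF T_pinj[OF rel] order_refl])
  have card1: "card D1 = card D0" unfolding D1_def by (rule card_Image_pinj[OF T_pinj[OF rel] D0])
  have fl1: "of_bool (D1 = Y) - of_bool (D0 = Y) = (\<Sum>R\<leftarrow>Rs. displacement R Y)" for Y
    unfolding D1_def using T D0 rank
    by (intro relprod_displacement) (auto simp: T_pinj T_finite D0_def w_def)
  have fl2: "of_bool (D2 = Y) - of_bool (D1 = Y) = (\<Sum>R\<leftarrow>Rs'. displacement R Y)" for Y
    unfolding D2_def using T D1 rank
    by (intro relprod_displacement) (auto simp: T_pinj T_finite card1 set_eq D0_def w_def)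
  have "(\<Sum>R\<leftarrow>Rs. displacement R Y) = (\<Sum>R\<leftarrow>Rs'. displacement R Y)" for Y
    by (simp add: mset flip: sum_mset_sum_list)
  then have eq: "of_bool (D1 = Y) - of_bool (D0 = Y) = (of_bool (D2 = Y) - of_bool (D1 = Y) :: int)" for Y
    using fl1 fl2 by metis
  \<comment> \<open>At \<open>Y = D1\<close> the left side of \<open>eq\<close> is nonnegative and
    the right side nonpositive, so both vanish.\<close>
  have "D1 = D0" using eq[of D1] by (auto simp: of_bool_def split: if_splits)
  moreover have "D2 = D1" using eq[of D1] \<open>D1 = D0\<close> by (auto simp: of_bool_def split: if_splits)
  moreover have "D2 = Range w" by (auto simp: D2_def D1_def D0_def w_eq)
  ultimately have "Domain w = Range w" by (simp add: D0_def)
  with T_aperiodic[OF w] show ?thesis by (simp add: w_def)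
qed

text \<open>Each level costs at least one unit of rank: by the anagram lemma, a value that is not a
  partial identity has a factor that is not one either and whose rank is different, hence
  larger.\<close>

lemma nested_word_rank:
  assumes n: "n > 0" and mset: "mset (map v [0..<n]) = mset (map v [n..<2 * n])"
    and "range \<phi> \<subseteq> T"
  defines "w \<equiv> \<lambda>\<phi> h. sr_eval (\<inter>) (O) \<phi> (nested_word n v h)"
  shows "w \<phi> h \<in> T \<and> (w \<phi> h \<subseteq> Id \<or> card (Domain (w \<phi> h)) + h \<le> card X)"
  using assms(3)
proof (induction h arbitrary: \<phi>)
  case 0
  then have "\<phi> 0 \<in> T" by auto
  then show ?case using T_subset[of "\<phi> 0"] finX by (auto simp: w_def intro!: card_mono)
next
  case (Suc h)
  define A where "A i = w (\<lambda>x. \<phi> (n * x + i)) h" for i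
  have A: "A i \<in> T" "A i \<subseteq> Id \<or> card (Domain (A i)) + h \<le> card X" for i
    using Suc.IH[of "\<lambda>x. \<phi> (n * x + i)"] Suc.prems by (auto simp: A_def)
  define Rs where "Rs = map A (map v [0..<n])"
  define Rs' where "Rs' = map A (map v [n..<2 * n])"
  have "[0..<2 * n] = [0..<n] @ [n..<2 * n]" using upt_add_eq_append[of 0 n n] by (simp add: mult_2)
  then have w: "w \<phi> (Suc h) = relprod (Rs @ Rs')"
    using eval_nested_word_Suc[OF n] by (simp add: w_def A_def Rs_def Rs'_def comp_def)
  have T: "set Rs \<subseteq> T" "set Rs' \<subseteq> T" "Rs \<noteq> []" using A n by (auto simp: Rs_def Rs'_def)
  have ms: "mset Rs = mset Rs'" using mset unfolding Rs_def Rs'_def by (metis mset_map)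
  have wT: "w \<phi> (Suc h) \<in> T" unfolding w using T by (intro relprod_in_T) auto
  moreover have "card (Domain (w \<phi> (Suc h))) + Suc h \<le> card X" if "\<not> w \<phi> (Suc h) \<subseteq> Id"
  proof -
    from that obtain R where R: "R \<in> set Rs" "\<not> R \<subseteq> Id"
      "card (Domain R) \<noteq> card (Domain (w \<phi> (Suc h)))"
      using anagram_product_idem[OF T ms] unfolding w by blast
    have "card (Domain (w \<phi> (Suc h))) \<le> card (Domain R)"
      unfolding w using R T by (intro card_Domain_relprod_le) auto
    moreover obtain i where "R = A i" using R by (auto simp: Rs_def)
    ultimately show ?thesis using R A(2)[of i] by auto
  qed
  ultimately show ?case by blast
qed

text \<open>At height \<open>card X\<close> the bound leaves only rank zero, and the empty relation
  is below \<open>Id\<close> as well.\<close>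

lemma nested_word_idem:
  assumes "n > 0" "mset (map v [0..<n]) = mset (map v [n..<2 * n])" "range \<phi> \<subseteq> T"
  shows "sr_eval (\<inter>) (O) \<phi> (nested_word n v (card X)) \<subseteq> Id"
proof -
  let ?w = "sr_eval (\<inter>) (O) \<phi> (nested_word n v (card X))"
  have "?w \<in> T" "?w \<subseteq> Id \<or> card (Domain ?w) + card X \<le> card X"
    using nested_word_rank[OF assms, of "card X"] by auto
  then show ?thesis using T_finite by (auto simp: finite_Domain)
qed

end

section \<open>Relations on the path of a nested word\<close>

text \<open>A relation on the points \<open>{0..(2n)^h}\<close> of the path: empty, a single pair, or a relation on
  the points of a block of length \<open>(2n)^(h - 1)\<close>, repeated in all blocks with the same letter.\<close>

datatype gadget = Empty | Single nat nat | Lift nat gadget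

lemma brandt_rels_mono:
  assumes "R \<in> brandt_rels" "Q \<subseteq> R"
  shows "Q \<in> brandt_rels"
  using assms(1)
proof cases
  case Id
  then have "Q \<subseteq> {(False, False), (True, True)}" using assms(2) by (simp add: Id_bool_eq)
  then have "Q = {} \<or> Q = {(False, False)} \<or> Q = {(True, True)} \<or> Q = Id"
    unfolding Id_bool_eq by (cases "(False, False) \<in> Q"; cases "(True, True) \<in> Q") blast+
  then show ?thesis by (auto intro: brandt_rels.intros)
qed (use assms(2) in \<open>auto simp: subset_singleton_iff intro: brandt_rels.intros\<close>)

lemma brandt_rels_const_image:
  assumes "\<And>p q. (p, q) \<in> R \<Longrightarrow> f p = f q"
  shows "map_prod f f ` R \<in> brandt_rels"
  by (rule brandt_rels_mono[OF brandt_rels.Id]) (use assms in auto)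

text \<open>Offsets run up to \<open>L\<close> inclusive, so the common end of two consecutive
  blocks has two descriptions.\<close>

lemma block_cases:
  fixes L :: nat
  assumes "t * L + p = t' * L + p'" "p \<le> L" "p' \<le> L" "L > 0"
  shows "t = t' \<and> p = p' \<or> t' = Suc t \<and> p = L \<and> p' = 0 \<or> t = Suc t' \<and> p = 0 \<and> p' = L"
proof -
  have *: "t' = Suc t \<and> p = L \<and> p' = 0"
    if lt: "t < t'" and eq: "t * L + p = t' * L + p'" and le: "p \<le> L" for t t' p p'
  proof -
    obtain d where d: "t' = Suc t + d" using less_imp_Suc_add[OF lt] by auto
    then have "p = L + d * L + p'" using eq by (simp add: algebra_simps)
    then show ?thesis using le d \<open>L > 0\<close> by auto
  qed
  show ?thesis using *[of t t' p p'] *[of t' t p' p] assms by (cases t t' rule: linorder_cases) auto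
qed

lemma Suc_mult_le_mono: "t < s \<Longrightarrow> t * L + L \<le> s * (L :: nat)"
  using mult_le_mono1[of "Suc t" s L] by simp

text \<open>\<open>I\<close> stands for the top-level letters of at most \<open>N\<close> gadgets.
  \<open>factor_unique\<close> helps to keep the blocks of two different letters from meeting at two
  points, \<open>no_repeat\<close> leaves at most one block per letter in a connected component, and
  \<open>no_swap\<close> makes the order of two letters the same in all components.\<close>

locale sparse_word =
  fixes n N :: nat and v :: "nat \<Rightarrow> nat"
  assumes n_pos: "n > 0" and N_ge_2: "N \<ge> 2"
    and letter_less: "t < 2 * n \<Longrightarrow> v t < n"
    and factor_unique: "Suc t < 2 * n \<Longrightarrow> Suc s < 2 * n \<Longrightarrow> v t = v s \<Longrightarrow> v (Suc t) = v (Suc s) \<Longrightarrow> t = s"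
    and no_repeat: "finite I \<Longrightarrow> card I \<le> N \<Longrightarrow> t < s \<Longrightarrow> s < 2 * n \<Longrightarrow> v ` {t..s} \<subseteq> I \<Longrightarrow> v t \<noteq> v s"
    and no_swap: "finite I \<Longrightarrow> card I \<le> N \<Longrightarrow> t < s \<Longrightarrow> s < 2 * n \<Longrightarrow> v ` {t..s} \<subseteq> I \<Longrightarrow>
      t' < s' \<Longrightarrow> s' < 2 * n \<Longrightarrow> v ` {t'..s'} \<subseteq> I \<Longrightarrow> v t = v s' \<Longrightarrow> v s \<noteq> v t'"
begin

lemma adjacent_neq:
  assumes "Suc t < 2 * n"
  shows "v t \<noteq> v (Suc t)"
proof (rule no_repeat)
  show "v ` {t..Suc t} \<subseteq> {v t, v (Suc t)}" by (auto simp: le_Suc_eq)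
  show "card {v t, v (Suc t)} \<le> N" using N_ge_2 by (simp add: card_insert_if)
qed (use assms in auto)

lemma adjacent_no_swap:
  assumes "Suc t < 2 * n" "Suc s < 2 * n" "v t = v (Suc s)"
  shows "v (Suc t) \<noteq> v s"
proof
  assume eq: "v (Suc t) = v s"
  have "v (Suc t) \<noteq> v s"
  proof (rule no_swap)
    show "v ` {t..Suc t} \<subseteq> {v t, v (Suc t)}" by (auto simp: le_Suc_eq)
    show "v ` {s..Suc s} \<subseteq> {v t, v (Suc t)}" using assms eq by (auto simp: le_Suc_eq)
    show "card {v t, v (Suc t)} \<le> N" using N_ge_2 by (simp add: card_insert_if)
  qed (use assms in auto)
  with eq show False by simp
qed

section \<open>Lifting relations from one block to all blocks with a given letter\<close>

definition len :: "nat \<Rightarrow> nat" where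
  "len h = (2 * n) ^ h"

lemma len_pos: "len h > 0"
  using n_pos by (simp add: len_def)

lemma len_Suc: "len (Suc h) = 2 * n * len h"
  by (simp add: len_def)

definition lift :: "nat \<Rightarrow> nat \<Rightarrow> (nat \<times> nat) set \<Rightarrow> (nat \<times> nat) set" where
  "lift L i R = {(t * L + p, t * L + q) | t p q. t < 2 * n \<and> v t = i \<and> (p, q) \<in> R}"

lemma liftI: "t < 2 * n \<Longrightarrow> v t = i \<Longrightarrow> (p, q) \<in> R \<Longrightarrow> (t * L + p, t * L + q) \<in> lift L i R"
  by (auto simp: lift_def)

lemma liftE:
  assumes "(x, y) \<in> lift L i R"
  obtains t p q where "t < 2 * n" "v t = i" "(p, q) \<in> R" "x = t * L + p" "y = t * L + q"
  using assms by (auto simp: lift_def)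

text \<open>Consecutive blocks carry different letters, so a shared end point is never ambiguous
  among the blocks of one letter. Hence \<open>lift\<close> respects injectivity, intersection and
  composition.\<close>

lemma lift_same_block:
  assumes "t * L + p = s * L + q" "p \<le> L" "q \<le> L" "L > 0" "t < 2 * n" "s < 2 * n" "v t = v s"
  shows "t = s \<and> p = q"
  using block_cases[OF assms(1-4)] adjacent_neq[of t] adjacent_neq[of s] assms(5-7) by auto

lemma lift_subset:
  assumes "R \<subseteq> {..L} \<times> {..L}"
  shows "lift L i R \<subseteq> {..2 * n * L} \<times> {..2 * n * L}"
proof -
  have "t * L + p \<le> 2 * n * L" if "t < 2 * n" "p \<le> L" for t p
    using Suc_mult_le_mono[OF that(1), of L] that(2) by linarith
  with assms show ?thesis by (fastforce simp: lift_def)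
qed

lemma pinj_lift:
  assumes "R \<subseteq> {..L} \<times> {..L}" "pinj R" "L > 0"
  shows "pinj (lift L i R)"
  unfolding pinj_def single_valued_def
proof (intro conjI allI impI; (simp only: converse_iff)?; elim liftE)
  fix x y z t p q t' p' q'
  assume *: "t < 2 * n" "v t = i" "(p, q) \<in> R" "t' < 2 * n" "v t' = i" "(p', q') \<in> R"
  { assume "x = t * L + p" "y = t * L + q" "x = t' * L + p'" "z = t' * L + q'"
    with * assms lift_same_block[of t L p t' p'] show "y = z" by (auto dest: pinj_fun) }
  { assume "y = t * L + p" "x = t * L + q" "z = t' * L + p'" "x = t' * L + q'"
    with * assms lift_same_block[of t L q t' q'] show "y = z" by (auto dest: pinj_inj) }
qed

lemma lift_Int:
  assumes "R \<subseteq> {..L} \<times> {..L}" "R' \<subseteq> {..L} \<times> {..L}" "L > 0"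
  shows "lift L i (R \<inter> R') = lift L i R \<inter> lift L i R'"
proof (intro equalityI subsetI)
  fix x assume "x \<in> lift L i R \<inter> lift L i R'"
  then obtain t p q t' p' q' where *: "t < 2 * n" "v t = i" "(p, q) \<in> R" "x = (t * L + p, t * L + q)"
      "t' < 2 * n" "v t' = i" "(p', q') \<in> R'" "x = (t' * L + p', t' * L + q')"
    by (auto simp: lift_def)
  with assms lift_same_block[of t L p t' p'] have "t = t' \<and> p = p'" by auto
  with * show "x \<in> lift L i (R \<inter> R')" by (auto intro!: liftI)
qed (auto simp: lift_def)

lemma lift_relcomp:
  assumes "R \<subseteq> {..L} \<times> {..L}" "R' \<subseteq> {..L} \<times> {..L}" "L > 0"
  shows "lift L i (R O R') = lift L i R O lift L i R'"
proof (intro equalityI subsetI)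
  fix x assume "x \<in> lift L i R O lift L i R'"
  then obtain t p q t' p' q' where *: "t < 2 * n" "v t = i" "(p, q) \<in> R" "fst x = t * L + p"
      "t * L + q = t' * L + p'" "t' < 2 * n" "v t' = i" "(p', q') \<in> R'" "snd x = t' * L + q'"
    by (elim relcompE liftE) (metis fst_conv snd_conv)
  with assms lift_same_block[of t L q t' p'] have "t = t' \<and> q = p'" by auto
  with * have "(fst x, snd x) \<in> lift L i (R O R')" by (auto intro!: liftI)
  then show "x \<in> lift L i (R O R')" by simp
qed (fastforce simp: lift_def)

text \<open>A two-letter factor occurs at most once and never together with its reversal; so the blocks of
  two distinct letters meet in at most one point of the whole path.\<close>

lemma common_point_unique:
  assumes "t < 2 * n" "t' < 2 * n" "s < 2 * n" "s' < 2 * n" "v t = v s" "v t' = v s'" "v t \<noteq> v t'"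
    and "t * L + p = t' * L + p'" "s * L + q = s' * L + q'"
    and "p \<le> L" "p' \<le> L" "q \<le> L" "q' \<le> L" "L > 0"
  shows "t * L + p = s * L + q"
proof -
  have 1: "t' = Suc t \<and> p = L \<and> p' = 0 \<or> t = Suc t' \<and> p = 0 \<and> p' = L"
    using block_cases[of t L p t' p'] assms by auto
  have 2: "s' = Suc s \<and> q = L \<and> q' = 0 \<or> s = Suc s' \<and> q = 0 \<and> q' = L"
    using block_cases[of s L q s' q'] assms by auto
  show ?thesis
    using 1 2 assms factor_unique[of t s] factor_unique[of t' s'] adjacent_no_swap[of t s'] adjacent_no_swap[of t' s]
    by auto
qed

section \<open>The relations denoted by gadgets and their closure properties\<close>

fun gwf :: "nat \<Rightarrow> gadget \<Rightarrow> bool" where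
  "gwf h Empty \<longleftrightarrow> True"
| "gwf h (Single p q) \<longleftrightarrow> p \<le> len h \<and> q \<le> len h"
| "gwf (Suc h) (Lift i g) \<longleftrightarrow> gwf h g"
| "gwf 0 (Lift i g) \<longleftrightarrow> False"

fun grel :: "nat \<Rightarrow> gadget \<Rightarrow> (nat \<times> nat) set" where
  "grel h Empty = {}"
| "grel h (Single p q) = {(p, q)}"
| "grel (Suc h) (Lift i g) = lift (len h) i (grel h g)"
| "grel 0 (Lift i g) = {}"

lemma grel_subset: "gwf h g \<Longrightarrow> grel h g \<subseteq> {..len h} \<times> {..len h}"
proof (induction h g rule: gwf.induct)
  case (3 h i g)
  then show ?case using lift_subset[of "grel h g" "len h"] by (simp add: len_Suc)
qed auto

lemma pinj_grel: "gwf h g \<Longrightarrow> pinj (grel h g)"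
proof (induction h g rule: gwf.induct)
  case (3 h i g)
  then show ?case using grel_subset[of h g] len_pos by (simp add: pinj_lift)
qed (auto simp: pinj_def single_valued_def)

definition grels :: "nat \<Rightarrow> (nat \<times> nat) set set" where
  "grels h = grel h ` {g. gwf h g}"

lemma grelsI: "gwf h g \<Longrightarrow> grel h g \<in> grels h"
  by (auto simp: grels_def)

lemma grelsE:
  assumes "R \<in> grels h"
  obtains g where "gwf h g" "R = grel h g"
  using assms by (auto simp: grels_def)

lemma lift_grels: "R \<in> grels h \<Longrightarrow> lift (len h) i R \<in> grels (Suc h)"
  by (elim grelsE) (use grelsI[of "Suc h" "Lift i g" for g] in auto)

lemma small_in_grels:
  assumes "R \<subseteq> {..len h} \<times> {..len h}" "\<And>a b. a \<in> R \<Longrightarrow> b \<in> R \<Longrightarrow> a = b"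
  shows "R \<in> grels h"
proof (cases "R = {}")
  case True
  then show ?thesis using grelsI[of h Empty] by simp
next
  case False
  then obtain p q where "(p, q) \<in> R" by auto
  with assms(2) have R: "R = {(p, q)}" by blast
  with assms(1) show ?thesis using grelsI[of h "Single p q"] by simp
qed

text \<open>Lifts with the same letter combine inside the block, by induction. Lifts with different
  letters meet in at most one point of the path, and a gadget other than a lift has at most one
  pair; in these cases the result has at most one pair and is \<open>Empty\<close> or a
  \<open>Single\<close>.\<close>

lemma grels_closed_aux:
  assumes R: "R \<in> grels h" and R': "R' \<in> grels h"
  shows "R \<inter> R' \<in> grels h \<and> R O R' \<in> grels h"
  using assms
proof (induction h arbitrary: R R' rule: less_induct)
  case (less h)
  from less.prems obtain g g' where g: "gwf h g" "R = grel h g" and g': "gwf h g'" "R' = grel h g'"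
    by (elim grelsE)
  note sub = grel_subset[OF g(1), folded g(2)] grel_subset[OF g'(1), folded g'(2)]
  note pinj = pinj_grel[OF g(1), folded g(2)] pinj_grel[OF g'(1), folded g'(2)]
  have subs: "R \<inter> R' \<subseteq> {..len h} \<times> {..len h}" "R O R' \<subseteq> {..len h} \<times> {..len h}"
    using sub by blast+
  show "R \<inter> R' \<in> grels h \<and> R O R' \<in> grels h"
  proof (cases "\<exists>k i j a b. h = Suc k \<and> g = Lift i a \<and> g' = Lift j b")
    case False
    then have single: "(\<exists>x. R \<subseteq> {x}) \<or> (\<exists>x. R' \<subseteq> {x})"
      using g g' by (cases h; cases g; cases g') auto
    have int: "a = b" if "a \<in> R \<inter> R'" "b \<in> R \<inter> R'" for a b
      using that single by blast
    have comp: "a = b" if ab: "a \<in> R O R'" "b \<in> R O R'" for a b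
    proof -
      obtain x y z x' y' z' where *: "a = (x, z)" "(x, y) \<in> R" "(y, z) \<in> R'"
        "b = (x', z')" "(x', y') \<in> R" "(y', z') \<in> R'"
        using ab by blast
      then have "y = y'" using single by blast
      with * show ?thesis using pinj_inj[OF pinj(1)] pinj_fun[OF pinj(2)] by blast
    qed
    show ?thesis using small_in_grels[OF subs(1) int] small_in_grels[OF subs(2) comp] by blast
  next
    case True
    then obtain k i j a b where h: "h = Suc k" "g = Lift i a" "g' = Lift j b" by blast
    define A B where "A = grel k a" and "B = grel k b"
    have AB: "A \<in> grels k" "B \<in> grels k" "A \<subseteq> {..len k} \<times> {..len k}" "B \<subseteq> {..len k} \<times> {..len k}"
      using g g' h by (auto simp: A_def B_def grelsI dest: grel_subset)
    have R: "R = lift (len k) i A" and R': "R' = lift (len k) j B"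
      using g g' h by (auto simp: A_def B_def)
    show ?thesis
    proof (cases "i = j")
      case True
      then show ?thesis
        using less.IH[OF _ AB(1,2)] AB(3,4) len_pos
        by (simp add: R R' h(1) lift_grels flip: lift_Int lift_relcomp)
    next
      case False
      \<comment> \<open>The disjunctions cover both uses: \<open>y\<close> is a first coordinate for
        the intersection and a middle point for the composition.\<close>
      have unique: "y = y'" if yy: "\<exists>x. (x, y) \<in> R \<or> (y, x) \<in> R" "\<exists>z. (y, z) \<in> R'"
        "\<exists>x. (x, y') \<in> R \<or> (y', x) \<in> R" "\<exists>z. (y', z) \<in> R'" for y y'
      proof -
        have blockR: "\<exists>t p. t < 2 * n \<and> v t = i \<and> p \<le> len k \<and> y = t * len k + p"
          if "\<exists>x. (x, y) \<in> R \<or> (y, x) \<in> R" for y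
          using that AB(3) unfolding R by (force elim!: liftE)
        have blockR': "\<exists>t p. t < 2 * n \<and> v t = j \<and> p \<le> len k \<and> y = t * len k + p"
          if "\<exists>z. (y, z) \<in> R'" for y
          using that AB(4) unfolding R' by (force elim!: liftE)
        obtain t p where "t < 2 * n" "v t = i" "p \<le> len k" "y = t * len k + p"
          using blockR[OF yy(1)] by blast
        moreover obtain t' p' where "t' < 2 * n" "v t' = j" "p' \<le> len k" "y = t' * len k + p'"
          using blockR'[OF yy(2)] by blast
        moreover obtain s q where "s < 2 * n" "v s = i" "q \<le> len k" "y' = s * len k + q"
          using blockR[OF yy(3)] by blast
        moreover obtain s' q' where "s' < 2 * n" "v s' = j" "q' \<le> len k" "y' = s' * len k + q'"
          using blockR'[OF yy(4)] by blast
        ultimately show ?thesis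
          using common_point_unique[of t t' s s' "len k" p p' q q'] False len_pos by auto
      qed
      have int: "a = b" if "a \<in> R \<inter> R'" "b \<in> R \<inter> R'" for a b
        using that unique[of "fst a" "fst b"] pinj_fun[OF pinj(1)] by (cases a; cases b) auto
      have comp: "a = b" if ab: "a \<in> R O R'" "b \<in> R O R'" for a b
      proof -
        obtain x y z x' y' z' where *: "a = (x, z)" "(x, y) \<in> R" "(y, z) \<in> R'"
          "b = (x', z')" "(x', y') \<in> R" "(y', z') \<in> R'"
          using ab by blast
        then have "y = y'" by (intro unique) auto
        with * show ?thesis using pinj_inj[OF pinj(1)] pinj_fun[OF pinj(2)] by blast
      qed
      show ?thesis using small_in_grels[OF subs(1) int] small_in_grels[OF subs(2) comp] by blast
    qed
  qed
qed

lemma grels_closed: "closed_under (grels h) (\<inter>)" "closed_under (grels h) (O)"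
  using grels_closed_aux by (auto simp: closed_under_def)

end

section \<open>Two-colourings of the path\<close>

primrec sr_vars :: "sr_term \<Rightarrow> nat set" where
  "sr_vars (Var i) = {i}"
| "sr_vars (Add s t) = sr_vars s \<union> sr_vars t"
| "sr_vars (Mul s t) = sr_vars s \<union> sr_vars t"

lemma finite_sr_vars: "finite (sr_vars t)"
  by (induction t) auto

lemma sr_eval_cong:
  "(\<And>i. i \<in> sr_vars t \<Longrightarrow> \<phi> i = \<psi> i) \<Longrightarrow> sr_eval add mul \<phi> t = sr_eval add mul \<psi> t"
  by (induction t) auto

context sparse_word
begin

text \<open>Two points are connected if every block that meets the open interval between them has its
  letter in \<open>I\<close>.\<close>

definition conn :: "nat \<Rightarrow> nat set \<Rightarrow> nat \<Rightarrow> nat \<Rightarrow> bool" where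
  "conn L I x y \<longleftrightarrow> x = y \<or>
     (\<forall>u<2 * n. min x y < u * L + L \<and> u * L < max x y \<longrightarrow> v u \<in> I)"

lemma conn_refl [simp]: "conn L I x x"
  by (simp add: conn_def)

lemma conn_sym: "conn L I x y \<Longrightarrow> conn L I y x"
  by (auto simp: conn_def min.commute max.commute)

text \<open>The inequalities in \<open>conn\<close> say that two open real intervals overlap. Since
  an overlap has positive length, it is not reduced to the single point \<open>y\<close>, so a block
  meeting the interval from \<open>x\<close> to \<open>z\<close> meets one of the other two
  intervals.\<close>

lemma conn_trans:
  assumes "conn L I x y" "conn L I y z" "L > 0"
  shows "conn L I x z"
proof (cases "x = y \<or> y = z")
  case False
  have "min x y < a + L \<and> a < max x y \<or> min y z < a + L \<and> a < max y z"
    if "min x z < a + L" "a < max x z" for a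
    using that \<open>L > 0\<close> by (auto simp: min_def max_def split: if_splits)
  with assms False show ?thesis unfolding conn_def by blast
qed (use assms in auto)

lemma conn_block:
  assumes "u < 2 * n" "v u \<in> I" "u * L \<le> x" "x \<le> u * L + L" "u * L \<le> y" "y \<le> u * L + L"
  shows "conn L I x y"
  unfolding conn_def
proof (intro disjI2 allI impI)
  fix w assume w: "min x y < w * L + L \<and> w * L < max x y"
  have "w = u"
    using Suc_mult_le_mono[of w u L] Suc_mult_le_mono[of u w L] w assms
    by (cases w u rule: linorder_cases) auto
  with assms show "v w \<in> I" by simp
qed

text \<open>Turns connectedness into the form required by \<open>no_repeat\<close> and
  \<open>no_swap\<close>. The interval between the left ends reaches only the blocks
  \<open>t\<close> to \<open>s - 1\<close>; hence the separate hypothesis on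
  \<open>v s\<close>.\<close>

lemma conn_window:
  assumes "conn L I (t * L) (s * L)" "t < s" "s < 2 * n" "v s \<in> I" "L > 0"
  shows "v ` {t..s} \<subseteq> I"
proof clarify
  fix u assume u: "u \<in> {t..s}"
  show "v u \<in> I"
  proof (cases "u = s")
    case False
    then have "u < s" using u by simp
    have "t * L \<le> u * L" using u by (intro mult_le_mono1) simp
    then have "t * L < u * L + L" using assms(5) by linarith
    moreover have "u * L < s * L" using \<open>u < s\<close> assms(5) by simp
    moreover have "t * L \<noteq> s * L" using assms by simp
    ultimately show ?thesis
      using assms(1) \<open>u < s\<close> assms(3) unfolding conn_def min_less_iff_disj less_max_iff_disj
      by (meson less_trans)
  qed (use assms in simp)
qed

text \<open>Two such blocks would bound a factor over \<open>I\<close> that begins and ends with the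
  same letter.\<close>

lemma conn_block_unique:
  assumes I: "finite I" "card I \<le> N" and L: "L > 0"
    and "t < 2 * n" "s < 2 * n" "v t = v s" "v t \<in> I" "conn L I x (t * L)" "conn L I x (s * L)"
  shows "t = s"
proof -
  have *: "\<not> t < s" if "s < 2 * n" "v t = v s" "v t \<in> I" "conn L I x (t * L)" "conn L I x (s * L)" for t s
  proof
    assume "t < s"
    have "v ` {t..s} \<subseteq> I"
      using conn_window[OF conn_trans[OF conn_sym[OF that(4)] that(5) L] \<open>t < s\<close>] that L by simp
    from no_repeat[OF I \<open>t < s\<close> that(1) this] that(2) show False by simp
  qed
  from *[of s t] *[of t s] assms show ?thesis by (auto simp: not_less)
qed

text \<open>In the opposite order, the two factors over \<open>I\<close> would have interchanged end
  letters, against \<open>no_swap\<close>; equality is excluded because the letters differ by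
  \<open>no_repeat\<close>.\<close>

lemma conn_block_order:
  assumes I: "finite I" "card I \<le> N" and L: "L > 0"
    and "t < s" "s < 2 * n" "v t \<in> I" "v s \<in> I" "conn L I (t * L) (s * L)"
    and "t' < 2 * n" "s' < 2 * n" "v t = v t'" "v s = v s'" "conn L I (t' * L) (s' * L)"
  shows "t' < s'"
proof (rule ccontr)
  assume "\<not> t' < s'"
  moreover have "v t \<noteq> v s"
    by (rule no_repeat[OF I assms(4,5) conn_window[OF assms(8,4,5,7) L]])
  ultimately have "s' < t'" using assms by (metis linorder_neqE_nat)
  have "v ` {t..s} \<subseteq> I" by (rule conn_window[OF assms(8,4,5,7) L])
  moreover have "v ` {s'..t'} \<subseteq> I"
    using conn_window[OF conn_sym[OF assms(13)] \<open>s' < t'\<close> assms(9) _ L] assms(6,11) by simp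
  ultimately have "v s \<noteq> v s'"
    by (rule no_swap[OF I assms(4,5) _ \<open>s' < t'\<close> assms(9) _ assms(11)])
  with assms(12) show False by simp
qed

section \<open>Construction of colourings by recursion on the height\<close>

definition colouring :: "nat \<Rightarrow> gadget set \<Rightarrow> (nat \<Rightarrow> bool) \<Rightarrow> bool" where
  "colouring h F f \<longleftrightarrow> (\<forall>g\<in>F. map_prod f f ` grel h g \<in> brandt_rels)"

definition active :: "gadget set \<Rightarrow> nat set" where
  "active F = {i. \<exists>g. Lift i g \<in> F}"

definition sub_gadgets :: "nat \<Rightarrow> gadget set \<Rightarrow> gadget set" where
  "sub_gadgets i F = {g. Lift i g \<in> F}"

lemma active_card:
  assumes "finite F"
  shows "finite (active F) \<and> card (active F) \<le> card F"
proof -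
  have "active F \<subseteq> (\<lambda>g. case g of Lift i g' \<Rightarrow> i | _ \<Rightarrow> 0) ` F"
    by (force simp: active_def)
  with assms show ?thesis by (meson card_image_le card_mono finite_imageI finite_subset le_trans)
qed

lemma sub_gadgets_card:
  assumes "finite F"
  shows "finite (sub_gadgets i F) \<and> card (sub_gadgets i F) \<le> card F"
proof -
  have "sub_gadgets i F \<subseteq> (\<lambda>g. case g of Lift i g' \<Rightarrow> g' | _ \<Rightarrow> Empty) ` F"
    by (force simp: sub_gadgets_def)
  with assms show ?thesis by (meson card_image_le card_mono finite_imageI finite_subset le_trans)
qed

lemma sub_gadgets_gwf: "\<forall>g\<in>F. gwf (Suc h) g \<Longrightarrow> \<forall>g\<in>sub_gadgets i F. gwf h g"
  by (auto simp: sub_gadgets_def)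

text \<open>A lift has an image in \<open>brandt_rels\<close> for one of two reasons:
  \<open>f\<close> is constant on each of its blocks, so that only pairs of equal colours arise, or
  \<open>f\<close> repeats one colouring \<open>f'\<close> on all of them, so that the image is
  contained in that of a single copy.\<close>

lemma colouring_SucI:
  assumes wf: "\<forall>g\<in>F. gwf (Suc h) g"
    and "\<And>i. i \<in> active F \<Longrightarrow>
      (\<forall>t<2 * n. v t = i \<longrightarrow> (\<forall>p\<le>len h. \<forall>q\<le>len h. f (t * len h + p) = f (t * len h + q))) \<or>
      (\<exists>f'. colouring h (sub_gadgets i F) f' \<and>
        (\<forall>t<2 * n. v t = i \<longrightarrow> (\<forall>p\<le>len h. f (t * len h + p) = f' p)))"
  shows "colouring (Suc h) F f"
  unfolding colouring_def
proof
  fix g assume g: "g \<in> F"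
  show "map_prod f f ` grel (Suc h) g \<in> brandt_rels"
  proof (cases g)
    case (Lift i g')
    have sub: "grel h g' \<subseteq> {..len h} \<times> {..len h}" using wf g Lift by (intro grel_subset) auto
    have "i \<in> active F" using g Lift by (auto simp: active_def)
    from assms(2)[OF this] show ?thesis
    proof (elim disjE exE conjE)
      assume "\<forall>t<2 * n. v t = i \<longrightarrow> (\<forall>p\<le>len h. \<forall>q\<le>len h. f (t * len h + p) = f (t * len h + q))"
      with sub show ?thesis
        unfolding Lift grel.simps by (intro brandt_rels_const_image) (auto elim!: liftE)
    next
      fix f' assume f': "colouring h (sub_gadgets i F) f'"
        "\<forall>t<2 * n. v t = i \<longrightarrow> (\<forall>p\<le>len h. f (t * len h + p) = f' p)"
      have "map_prod f' f' ` grel h g' \<in> brandt_rels"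
        using f'(1) g Lift by (auto simp: colouring_def sub_gadgets_def)
      moreover have "map_prod f f ` grel (Suc h) g \<subseteq> map_prod f' f' ` grel h g'"
      proof
        fix y assume "y \<in> map_prod f f ` grel (Suc h) g"
        then obtain t p q where "t < 2 * n" "v t = i" "(p, q) \<in> grel h g'"
          "y = (f (t * len h + p), f (t * len h + q))" unfolding Lift by (auto elim!: liftE)
        moreover from this have "y = map_prod f' f' (p, q)" using f'(2) sub by auto
        ultimately show "y \<in> map_prod f' f' ` grel h g'" by blast
      qed
      ultimately show ?thesis by (rule brandt_rels_mono)
    qed
  qed (auto intro: brandt_rels.intros)
qed

text \<open>A block with an active letter lies in one component, so the indicator of a component is
  constant on it.\<close>

lemma colouring_conn:
  assumes "\<forall>g\<in>F. gwf (Suc h) g"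
  shows "colouring (Suc h) F (\<lambda>x. conn (len h) (active F) x y)"
proof (rule colouring_SucI[OF assms], intro disjI1 allI impI)
  fix i t p q assume "i \<in> active F" "t < 2 * n" "v t = i" "p \<le> len h" "q \<le> len h"
  then have "conn (len h) (active F) (t * len h + p) (t * len h + q)"
    by (intro conn_block) auto
  then show "conn (len h) (active F) (t * len h + p) y = conn (len h) (active F) (t * len h + q) y"
    using conn_trans conn_sym len_pos by blast
qed

text \<open>A connected component contains at most one block with letter \<open>i\<close>. A colouring of that block is
  extended to the component by the colours of its two ends.\<close>

lemma extend_colouring:
  assumes wf: "\<forall>g\<in>F. gwf (Suc h) g" and F: "finite F" "card F \<le> N"
    and i: "i \<in> active F" and f': "colouring h (sub_gadgets i F) f'"
  shows "\<exists>f. colouring (Suc h) F f \<and>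
    (\<forall>t x. t < 2 * n \<longrightarrow> v t = i \<longrightarrow> conn (len h) (active F) x (t * len h) \<longrightarrow>
      f x = f' (min (len h) (x - t * len h))) \<and>
    (\<forall>x. (\<forall>t. t < 2 * n \<longrightarrow> v t = i \<longrightarrow> \<not> conn (len h) (active F) x (t * len h)) \<longrightarrow> f x = c)"
proof -
  define L where "L = len h"
  have L: "L > 0" by (simp add: L_def len_pos)
  define linked where "linked x t \<longleftrightarrow> t < 2 * n \<and> v t = i \<and> conn L (active F) x (t * L)" for x t
  have I: "finite (active F)" "card (active F) \<le> N" using active_card[OF F(1)] F(2) by auto
  have unique: "t = s" if "linked x t" "linked x s" for x t s
    using that i conn_block_unique[OF I L] by (auto simp: linked_def)
  \<comment> \<open>With truncated subtraction, \<open>min L (x - t * L)\<close> clamps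
    \<open>x\<close> to block \<open>t\<close>: the value is \<open>0\<close> to its left and
    \<open>L\<close> to its right. \<open>c\<close> colours the components without the letter
    \<open>i\<close>.\<close>
  define f where "f x = (if \<exists>t. linked x t then f' (min L (x - (SOME t. linked x t) * L)) else c)" for x
  have f1: "f x = f' (min L (x - t * L))" if "linked x t" for x t
  proof -
    have "(SOME t. linked x t) = t" using that unique by blast
    then show ?thesis using that unfolding f_def by auto
  qed
  have f2: "f x = c" if "\<And>t. \<not> linked x t" for x
    using that by (simp add: f_def)
  have e1: "f x = f' (min (len h) (x - t * len h))"
    if "t < 2 * n" "v t = i" "conn (len h) (active F) x (t * len h)" for t x
    using f1[of x t] that by (simp add: linked_def L_def)
  have e2: "f x = c" if "\<And>t. t < 2 * n \<Longrightarrow> v t = i \<Longrightarrow> \<not> conn (len h) (active F) x (t * len h)" for x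
    using f2[of x] that by (auto simp: linked_def L_def)
  have "colouring (Suc h) F f"
  proof (rule colouring_SucI[OF wf])
    fix j assume j: "j \<in> active F"
    have cb: "conn L (active F) (t * L + p) (t * L + q)"
      if "t < 2 * n" "v t = j" "p \<le> L" "q \<le> L" for t p q
      using that j by (intro conn_block) auto
    show "(\<forall>t<2 * n. v t = j \<longrightarrow> (\<forall>p\<le>len h. \<forall>q\<le>len h. f (t * len h + p) = f (t * len h + q))) \<or>
      (\<exists>f'. colouring h (sub_gadgets j F) f' \<and>
        (\<forall>t<2 * n. v t = j \<longrightarrow> (\<forall>p\<le>len h. f (t * len h + p) = f' p)))"
    proof (cases "j = i")
      case True
      have "f (t * L + p) = f' p" if "t < 2 * n" "v t = j" "p \<le> L" for t p
        using f1[of "t * L + p" t] cb[of t p 0] that True by (simp add: linked_def)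
      with True f' show ?thesis by (auto simp: L_def)
    next
      case False
      have "f (t * L + p) = f (t * L + q)" if t: "t < 2 * n" "v t = j" "p \<le> L" "q \<le> L" for t p q
      proof (cases "\<exists>s. linked (t * L + p) s")
        case True
        then obtain s where s: "linked (t * L + p) s" by blast
        then have s': "linked (t * L + q) s"
          using cb[OF t(1,2,4,3)] L unfolding linked_def by (blast intro: conn_trans)
        \<comment> \<open>A block with another letter lies on one side of block \<open>s\<close>, so
          all its points are clamped to the same end.\<close>
        have "s \<noteq> t" using s t False by (auto simp: linked_def)
        then have "min L (t * L + p - s * L) = min L (t * L + q - s * L)"
          using Suc_mult_le_mono[of s t L] Suc_mult_le_mono[of t s L] t by (cases s t rule: linorder_cases) auto
        then show ?thesis by (simp add: f1[OF s] f1[OF s'])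
      next
        case no: False
        then have "\<not> linked (t * L + q) s" for s
          using cb[OF t] L unfolding linked_def by (blast intro: conn_trans)
        with no show ?thesis by (simp add: f2)
      qed
      then show ?thesis unfolding L_def by blast
    qed
  qed
  then show ?thesis using e1 e2 by blast
qed

lemma colouring_0: "\<forall>g\<in>F. gwf 0 g \<Longrightarrow> colouring 0 F f"
  unfolding colouring_def
proof
  fix g assume "\<forall>g\<in>F. gwf 0 g" "g \<in> F"
  then show "map_prod f f ` grel 0 g \<in> brandt_rels"
    by (cases g) (auto intro: brandt_rels.intros)
qed

lemma block_of:
  assumes "x < 2 * n * len h"
  obtains u where "u < 2 * n" "u * len h \<le> x" "x < u * len h + len h"
proof
  show "x div len h < 2 * n" using assms len_pos by (simp add: less_mult_imp_div_less)
  show "x div len h * len h \<le> x" by simp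
  show "x < x div len h * len h + len h"
    using len_pos[of h] by (metis div_mult_mod_eq mod_less_divisor add_less_cancel_left)
qed

text \<open>Points in different components are separated by the indicator of a component. Otherwise
  both are clamped to the block of the left point, separated there by induction, and the colouring
  is extended.\<close>

lemma separating_colouring:
  assumes "finite F" "card F \<le> N" "\<forall>g\<in>F. gwf h g" "q \<le> len h" "q' \<le> len h" "q \<noteq> q'"
  shows "\<exists>f. colouring h F f \<and> f q \<noteq> f q'"
  using assms
proof (induction h arbitrary: F q q')
  case 0
  then show ?case by (intro exI[of _ "\<lambda>x. x = q"]) (auto simp: colouring_0)
next
  case (Suc h)
  have less: "\<exists>f. colouring (Suc h) F f \<and> f q \<noteq> f q'" if q: "q < q'" "q' \<le> len (Suc h)" for q q'
  proof (cases "conn (len h) (active F) q q'")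
    case False
    then show ?thesis
      using colouring_conn[OF Suc.prems(3), of q] conn_sym by (metis conn_refl)
  next
    case True
    \<comment> \<open>As the right end is excluded, the block of \<open>q\<close> overlaps the
      interval up to \<open>q'\<close>, so its letter is active, and \<open>q'\<close> is clamped to
      a different point than \<open>q\<close>.\<close>
    obtain u where u: "u < 2 * n" "u * len h \<le> q" "q < u * len h + len h"
      using block_of[of q h] q by (auto simp: len_Suc)
    have "v u \<in> active F" using True u q by (auto simp: conn_def)
    note sub = sub_gadgets_card[OF Suc.prems(1), of "v u"]
    have "min (len h) (q' - u * len h) \<noteq> min (len h) (q - u * len h)" using u q by auto
    then obtain f' where f': "colouring h (sub_gadgets (v u) F) f'"
      "f' (min (len h) (q' - u * len h)) \<noteq> f' (min (len h) (q - u * len h))"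
      using Suc.IH[OF conjunct1[OF sub] le_trans[OF conjunct2[OF sub] Suc.prems(2)]
          sub_gadgets_gwf[OF Suc.prems(3)] min.cobounded1 min.cobounded1] by blast
    obtain f where f: "colouring (Suc h) F f"
      "\<forall>t x. t < 2 * n \<longrightarrow> v t = v u \<longrightarrow> conn (len h) (active F) x (t * len h) \<longrightarrow>
        f x = f' (min (len h) (x - t * len h))"
      using extend_colouring[OF Suc.prems(3,1,2) \<open>v u \<in> active F\<close> f'(1)] by blast
    have c: "conn (len h) (active F) q (u * len h)"
      using u \<open>v u \<in> active F\<close> by (intro conn_block) auto
    then have "conn (len h) (active F) q' (u * len h)"
      using True len_pos conn_sym conn_trans by blast
    with c f(2)[rule_format, OF u(1) HOL.refl] f(1) f'(2) show ?thesis by metis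
  qed
  from Suc.prems(6) less[of q q'] less[of q' q] Suc.prems(4,5) show ?case
    by (metis linorder_neqE_nat)
qed

text \<open>For a lift with letter \<open>i\<close>, the indicator of the component of
  \<open>r\<close> works if that component has no block of letter \<open>i\<close>. Otherwise
  \<open>r\<close> is clamped to that block; if the clamped point \<open>r'\<close> avoids the
  smaller domain, the induction hypothesis is extended. If not, \<open>r\<close> lies outside the
  block, in another block \<open>u\<close>, and a colouring of \<open>u\<close> is chosen that gives
  the whole domain of the lift one colour.\<close>

lemma avoiding_colouring:
  assumes "finite F" "card F \<le> N" "\<forall>g\<in>F. gwf h g" "g \<in> F" "r \<le> len h" "r \<notin> Domain (grel h g)"
  shows "\<exists>f. colouring h F f \<and> f r \<notin> f ` Domain (grel h g)"
  using assms
proof (induction h arbitrary: F r g)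
  case 0
  then have "gwf 0 g" by blast
  with 0 show ?case by (intro exI[of _ "\<lambda>x. x = r"]) (cases g; auto simp: colouring_0)
next
  case (Suc h)
  show ?case
  proof (cases g)
    case Empty
    then show ?thesis using colouring_conn[OF Suc.prems(3)] by auto
  next
    case (Single p q)
    then show ?thesis using separating_colouring[OF Suc.prems(1-3), of r p] Suc.prems by auto
  next
    case (Lift i g')
    define L where "L = len h"
    have L: "L > 0" by (simp add: L_def len_pos)
    have i: "i \<in> active F" using Lift Suc.prems by (auto simp: active_def)
    note subc = sub_gadgets_card[OF Suc.prems(1)]
    have g': "g' \<in> sub_gadgets i F" using Lift Suc.prems(4) by (simp add: sub_gadgets_def)
    have wf': "gwf h g'" "\<forall>g\<in>sub_gadgets j F. gwf h g" for j
      using Lift Suc.prems(3,4) by (auto simp: sub_gadgets_def)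
    have sub: "Domain (grel h g') \<subseteq> {..L}" using grel_subset[OF wf'(1)] by (auto simp: L_def)
    have dom: "\<exists>s p. s < 2 * n \<and> v s = i \<and> p \<in> Domain (grel h g') \<and> p \<le> L \<and> x = s * L + p \<and>
        conn L (active F) x (s * L)" if x: "x \<in> Domain (grel (Suc h) g)" for x
    proof -
      obtain s p q where s: "s < 2 * n" "v s = i" "(p, q) \<in> grel h g'" "x = s * L + p"
        using x unfolding Lift L_def by (auto elim!: liftE)
      moreover have "p \<le> L" using s sub by auto
      moreover have "conn L (active F) x (s * L)" using s \<open>p \<le> L\<close> i by (intro conn_block) auto
      ultimately show ?thesis by blast
    qed
    have I: "finite (active F)" "card (active F) \<le> N" using active_card[of F] Suc.prems by auto
    show ?thesis
    proof (cases "\<exists>t<2 * n. v t = i \<and> conn L (active F) r (t * L)")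
      case False
      have "\<not> conn L (active F) x r" if x: "x \<in> Domain (grel (Suc h) g)" for x
        using dom[OF x] False conn_trans[OF conn_sym _ L] by blast
      then show ?thesis
        using colouring_conn[OF Suc.prems(3), of r]
        by (intro exI[of _ "\<lambda>x. conn L (active F) x r"]) (auto simp: L_def)
    next
      case True
      then obtain t where t: "t < 2 * n" "v t = i" "conn L (active F) r (t * L)" by blast
      define r' where "r' = min L (r - t * L)"
      have r'_le: "r' \<le> len h" by (simp add: r'_def L_def)
      show ?thesis
      proof (cases "r' \<in> Domain (grel h g')")
        case False
        then obtain f' where f': "colouring h (sub_gadgets i F) f'" "f' r' \<notin> f' ` Domain (grel h g')"
          using Suc.IH[OF conjunct1[OF subc] le_trans[OF conjunct2[OF subc] Suc.prems(2)] wf'(2) g' r'_le] by blast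
        obtain f where f: "colouring (Suc h) F f"
          "\<forall>t x. t < 2 * n \<longrightarrow> v t = i \<longrightarrow> conn L (active F) x (t * L) \<longrightarrow> f x = f' (min L (x - t * L))"
          using extend_colouring[OF Suc.prems(3,1,2) i f'(1)] unfolding L_def by blast
        have D: "f x \<in> f' ` Domain (grel h g')" if x: "x \<in> Domain (grel (Suc h) g)" for x
          using dom[OF x] f(2)[rule_format] by force
        have fr: "f r = f' r'" using f(2)[rule_format, OF t] by (simp add: r'_def)
        have "f r \<notin> f ` Domain (grel (Suc h) g)"
        proof
          assume "f r \<in> f ` Domain (grel (Suc h) g)"
          then obtain x where "x \<in> Domain (grel (Suc h) g)" "f r = f x" by (rule imageE)
          with D[of x] fr f'(2) show False by simp
        qed
        with f(1) show ?thesis by blast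
      next
        case r': True
        have "\<not> (t * L \<le> r \<and> r \<le> t * L + L)"
        proof
          assume "t * L \<le> r \<and> r \<le> t * L + L"
          then have "r = t * L + r'" by (auto simp: r'_def)
          then have "r \<in> Domain (grel (Suc h) g)" using r' t unfolding Lift L_def by (auto intro!: liftI)
          with Suc.prems show False by simp
        qed
        then consider "r < t * L" | "t * L + L < r" by linarith
        \<comment> \<open>\<open>e\<close> is the end of block \<open>u\<close> facing
          \<open>t\<close>. The block is chosen half-open towards \<open>t\<close>, so
          \<open>r\<close> is not this end.\<close>
        then obtain u e where u: "u < 2 * n" "u \<noteq> t" "conn L (active F) r (u * L)" "v u \<in> active F"
          and e: "u * L \<le> r" "r \<le> u * L + L" "r \<noteq> u * L + e" "e \<le> L"
          "u < t \<Longrightarrow> e = L" "t < u \<Longrightarrow> e = 0"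
        proof cases
          case 1
          have "t * L \<le> 2 * n * L" using t(1) by (intro mult_le_mono1) simp
          then have "r < 2 * n * len h" using 1 unfolding L_def by linarith
          then obtain u where u: "u < 2 * n" "u * L \<le> r" "r < u * L + L"
            using block_of unfolding L_def by blast
          have "u < t" using u(2) 1 by (meson le_less_trans mult_less_cancel2)
          have vu: "v u \<in> active F" using t(3) 1 u \<open>u < t\<close> by (auto simp: conn_def)
          moreover have "conn L (active F) r (u * L)" using u vu by (intro conn_block) auto
          ultimately show ?thesis using u \<open>u < t\<close> by (intro that[of u L]) auto
        next
          case 2
          have "r - 1 < 2 * n * len h" using 2 Suc.prems(5) by (simp add: len_Suc)
          then obtain u where u: "u < 2 * n" "u * L \<le> r - 1" "r - 1 < u * L + L"
            using block_of unfolding L_def by blast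
          have "t < u" using u 2 Suc_mult_le_mono[of u t L] by (cases t u rule: linorder_cases) auto
          have vu: "v u \<in> active F" using t(3) 2 u by (auto simp: conn_def)
          moreover have "conn L (active F) r (u * L)" using u vu 2 by (intro conn_block) auto
          ultimately show ?thesis using u \<open>t < u\<close> 2 by (intro that[of u 0]) auto
        qed
        have "r - u * L \<le> L" "r - u * L \<noteq> e" using e by auto
        then obtain f' where f': "colouring h (sub_gadgets (v u) F) f'" "f' (r - u * L) \<noteq> f' e"
          using separating_colouring[OF conjunct1[OF subc] le_trans[OF conjunct2[OF subc] Suc.prems(2)] wf'(2)]
            e(4) unfolding L_def by blast
        \<comment> \<open>Components without a block of letter \<open>v u\<close> also receive the
          colour \<open>f' e\<close>.\<close>
        obtain f where f: "colouring (Suc h) F f"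
          "\<forall>s x. s < 2 * n \<longrightarrow> v s = v u \<longrightarrow> conn L (active F) x (s * L) \<longrightarrow> f x = f' (min L (x - s * L))"
          "\<forall>x. (\<forall>s. s < 2 * n \<longrightarrow> v s = v u \<longrightarrow> \<not> conn L (active F) x (s * L)) \<longrightarrow> f x = f' e"
          using extend_colouring[OF Suc.prems(3,1,2) u(4) f'(1), of "f' e"] unfolding L_def by blast
        have ut: "conn L (active F) (u * L) (t * L)"
          using u(3) t(3) L conn_sym conn_trans by blast
        have D: "f x = f' e" if x: "x \<in> Domain (grel (Suc h) g)" for x
        proof (cases "\<exists>w<2 * n. v w = v u \<and> conn L (active F) x (w * L)")
          case True
          then obtain w where w: "w < 2 * n" "v w = v u" "conn L (active F) x (w * L)" by blast
          obtain s p where s: "s < 2 * n" "v s = i" "p \<le> L" "x = s * L + p" "conn L (active F) x (s * L)"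
            using dom[OF x] by blast
          have ws: "conn L (active F) (w * L) (s * L)" using w(3) s(5) L conn_sym conn_trans by blast
          \<comment> \<open>In the component of \<open>x\<close>, the blocks of letters
            \<open>v u\<close> and \<open>i\<close> are ordered as \<open>u\<close> and
            \<open>t\<close> are, so \<open>x\<close> is clamped to the end \<open>e\<close> of
            block \<open>w\<close>.\<close>
          have "min L (x - w * L) = e"
          proof (cases "u < t")
            case True
            have "w < s" using conn_block_order[OF I L True t(1) u(4) _ ut w(1) s(1) _ _ ws] t w s i by auto
            then show ?thesis using Suc_mult_le_mono[of w s L] s e(5) True by auto
          next
            case False
            then have "t < u" using u by simp
            have "s < w"
              using conn_block_order[OF I L \<open>t < u\<close> u(1) _ u(4) conn_sym[OF ut] s(1) w(1) _ _ conn_sym[OF ws]] t w s i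
              by auto
            then show ?thesis using Suc_mult_le_mono[of s w L] s e(6) \<open>t < u\<close> by auto
          qed
          then show ?thesis using f(2)[rule_format, OF w] by simp
        next
          case False
          then show ?thesis using f(3) by blast
        qed
        have fr: "f r = f' (r - u * L)"
          using f(2)[rule_format, OF u(1) HOL.refl u(3)] \<open>r - u * L \<le> L\<close> by (simp add: min_absorb2)
        have "f r \<notin> f ` Domain (grel (Suc h) g)"
        proof
          assume "f r \<in> f ` Domain (grel (Suc h) g)"
          then obtain x where "x \<in> Domain (grel (Suc h) g)" "f r = f x" by (rule imageE)
          with D[of x] fr f'(2) show False by simp
        qed
        with f(1) show ?thesis by blast
      qed
    qed
  qed
qed

section \<open>Transfer of identities from the Brandt monoid to the gadget relations\<close>

lemma eval_image_mono:
  "(p, q) \<in> sr_eval (\<inter>) (O) \<phi> t \<Longrightarrow> (f p, f q) \<in> sr_eval (\<inter>) (O) (\<lambda>i. map_prod f f ` \<phi> i) t"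
proof (induction t arbitrary: p q)
  case (Var i)
  then show ?case using image_eqI[of "(f p, f q)" "map_prod f f" "(p, q)"] by simp
qed fastforce+

lemma pinj_eval:
  assumes "\<And>i. pinj (\<phi> i)"
  shows "pinj (sr_eval (\<inter>) (O) \<phi> t)"
proof (induction t)
  case (Add s t)
  then show ?case by (auto simp: pinj_def single_valued_def)
qed (use assms in \<open>auto intro: pinj_relcomp\<close>)

text \<open>Undefinedness is visible in some two-coloured quotient. If two summands are defined at
  \<open>p\<close> with different values, a colouring separating the values makes the sum undefined.
  If the right factor of a product fails at the intermediate point \<open>q\<close>, a colouring for
  \<open>q\<close> serves for \<open>p\<close>, as the left factor sends \<open>f p\<close> only to
  \<open>f q\<close>.\<close>

lemma eval_defined_or_avoided:
  assumes F: "finite F" "card F \<le> N" "\<forall>g\<in>F. gwf h g" and \<gamma>: "range \<gamma> \<subseteq> F" and p: "p \<le> len h"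
  defines "\<psi> \<equiv> \<lambda>f i. map_prod f f ` grel h (\<gamma> i)"
  shows "(\<exists>q\<le>len h. (p, q) \<in> sr_eval (\<inter>) (O) (\<lambda>i. grel h (\<gamma> i)) t) \<or>
    (\<exists>f. colouring h F f \<and> f p \<notin> Domain (sr_eval (\<inter>) (O) (\<psi> f) t))"
  using p
proof (induction t arbitrary: p)
  case (Var i)
  have g: "\<gamma> i \<in> F" using \<gamma> by blast
  have dom: "Domain (map_prod f f ` R) = f ` Domain R" for f :: "nat \<Rightarrow> bool" and R by force
  show ?case
  proof (cases "p \<in> Domain (grel h (\<gamma> i))")
    case True
    then obtain q where "(p, q) \<in> grel h (\<gamma> i)" by blast
    moreover from this have "q \<le> len h" using grel_subset F(3) g by blast
    ultimately show ?thesis by auto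
  next
    case False
    then show ?thesis using avoiding_colouring[OF F g Var] by (simp add: \<psi>_def dom)
  qed
next
  case (Add s t)
  show ?case
  proof (cases "(\<exists>q\<le>len h. (p, q) \<in> sr_eval (\<inter>) (O) (\<lambda>i. grel h (\<gamma> i)) s) \<and>
      (\<exists>q\<le>len h. (p, q) \<in> sr_eval (\<inter>) (O) (\<lambda>i. grel h (\<gamma> i)) t)")
    case False
    then obtain f where "colouring h F f"
      "f p \<notin> Domain (sr_eval (\<inter>) (O) (\<psi> f) s) \<or> f p \<notin> Domain (sr_eval (\<inter>) (O) (\<psi> f) t)"
      using Add by blast
    then show ?thesis by (intro disjI2 exI[of _ f]) auto
  next
    case True
    then obtain q q' where q: "q \<le> len h" "(p, q) \<in> sr_eval (\<inter>) (O) (\<lambda>i. grel h (\<gamma> i)) s"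
      "q' \<le> len h" "(p, q') \<in> sr_eval (\<inter>) (O) (\<lambda>i. grel h (\<gamma> i)) t" by blast
    show ?thesis
    proof (cases "q = q'")
      case True
      with q show ?thesis by auto
    next
      case False
      then obtain f where f: "colouring h F f" "f q \<noteq> f q'"
        using separating_colouring[OF F q(1,3)] by blast
      have pinj: "pinj (sr_eval (\<inter>) (O) (\<psi> f) u)" for u
        using f(1) \<gamma> by (intro pinj_eval pinj_brandt_rels) (auto simp: \<psi>_def colouring_def)
      have "(f p, f q) \<in> sr_eval (\<inter>) (O) (\<psi> f) s" "(f p, f q') \<in> sr_eval (\<inter>) (O) (\<psi> f) t"
        using eval_image_mono[OF q(2), of f] eval_image_mono[OF q(4), of f] by (auto simp: \<psi>_def)
      then have "y = f q \<and> y = f q'"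
        if "(f p, y) \<in> sr_eval (\<inter>) (O) (\<psi> f) s" "(f p, y) \<in> sr_eval (\<inter>) (O) (\<psi> f) t" for y
        using that pinj_fun[OF pinj] by blast
      then have "f p \<notin> Domain (sr_eval (\<inter>) (O) (\<psi> f) (Add s t))"
        using f(2) unfolding sr_eval.simps by blast
      with f(1) show ?thesis by blast
    qed
  qed
next
  case (Mul s t)
  show ?case
  proof (cases "\<exists>q\<le>len h. (p, q) \<in> sr_eval (\<inter>) (O) (\<lambda>i. grel h (\<gamma> i)) s")
    case False
    then obtain f where "colouring h F f" "f p \<notin> Domain (sr_eval (\<inter>) (O) (\<psi> f) s)"
      using Mul by blast
    then show ?thesis by (intro disjI2 exI[of _ f]) auto
  next
    case True
    then obtain q where q: "q \<le> len h" "(p, q) \<in> sr_eval (\<inter>) (O) (\<lambda>i. grel h (\<gamma> i)) s" by blast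
    show ?thesis
    proof (cases "\<exists>q'\<le>len h. (q, q') \<in> sr_eval (\<inter>) (O) (\<lambda>i. grel h (\<gamma> i)) t")
      case True
      with q show ?thesis by auto
    next
      case False
      then obtain f where f: "colouring h F f" "f q \<notin> Domain (sr_eval (\<inter>) (O) (\<psi> f) t)"
        using Mul.IH(2)[OF q(1)] by blast
      have pinj: "pinj (sr_eval (\<inter>) (O) (\<psi> f) s)"
        using f(1) \<gamma> by (intro pinj_eval pinj_brandt_rels) (auto simp: \<psi>_def colouring_def)
      have "(f p, f q) \<in> sr_eval (\<inter>) (O) (\<psi> f) s"
        using eval_image_mono[OF q(2), of f] by (auto simp: \<psi>_def)
      then have "f p \<notin> Domain (sr_eval (\<inter>) (O) (\<psi> f) (Mul s t))"
        using f(2) pinj_fun[OF pinj] by (auto simp: Domain_iff)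
      with f(1) show ?thesis by blast
    qed
  qed
qed

text \<open>By the identity, \<open>t\<close> is defined at \<open>f p\<close> for every colouring
  \<open>f\<close>, hence it has a value \<open>q'\<close> at \<open>p\<close>. If \<open>q'\<close>
  differed from \<open>q\<close>, a separating colouring would give \<open>s\<close> two values at
  \<open>f p\<close>.\<close>

lemma gadget_eval_subset:
  assumes B: "sr_satisfies brandt_rels (\<inter>) (O) (s, t)"
    and F: "finite F" "card F \<le> N" "\<forall>g\<in>F. gwf h g" and \<gamma>: "range \<gamma> \<subseteq> F"
  shows "sr_eval (\<inter>) (O) (\<lambda>i. grel h (\<gamma> i)) s \<subseteq> sr_eval (\<inter>) (O) (\<lambda>i. grel h (\<gamma> i)) t"
proof (rule subrelI)
  fix p q assume pq: "(p, q) \<in> sr_eval (\<inter>) (O) (\<lambda>i. grel h (\<gamma> i)) s"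
  define \<psi> where "\<psi> f = (\<lambda>i. map_prod f f ` grel h (\<gamma> i))" for f :: "nat \<Rightarrow> bool"
  have \<psi>: "range (\<psi> f) \<subseteq> brandt_rels" if "colouring h F f" for f
    using that \<gamma> by (auto simp: \<psi>_def colouring_def)
  have eq: "sr_eval (\<inter>) (O) (\<psi> f) s = sr_eval (\<inter>) (O) (\<psi> f) t" if "colouring h F f" for f
    using B \<psi>[OF that] by (simp add: sr_satisfies_def)
  have pinj: "pinj (sr_eval (\<inter>) (O) (\<psi> f) u)" if "colouring h F f" for f u
    using \<psi>[OF that] by (intro pinj_eval pinj_brandt_rels) blast
  have im: "(f p, f q) \<in> sr_eval (\<inter>) (O) (\<psi> f) s" for f
    using eval_image_mono[OF pq, of f] by (simp add: \<psi>_def comp_def)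
  have "sr_eval (\<inter>) (O) (\<lambda>i. grel h (\<gamma> i)) s \<in> grels h"
    using \<gamma> F(3) by (intro sr_eval_closed grels_closed) (auto intro!: grelsI)
  then have pq_le: "p \<le> len h" "q \<le> len h" using pq by (auto elim!: grelsE dest: grel_subset)
  have "f p \<in> Domain (sr_eval (\<inter>) (O) (\<psi> f) t)" if "colouring h F f" for f
    using im[of f] eq[OF that] by auto
  then obtain q' where q': "q' \<le> len h" "(p, q') \<in> sr_eval (\<inter>) (O) (\<lambda>i. grel h (\<gamma> i)) t"
    using eval_defined_or_avoided[OF F \<gamma> pq_le(1), of t] unfolding \<psi>_def by blast
  have "q = q'"
  proof (rule ccontr)
    assume "q \<noteq> q'"
    then obtain f where f: "colouring h F f" "f q \<noteq> f q'"
      using separating_colouring[OF F pq_le(2) q'(1)] by blast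
    have "(f p, f q') \<in> sr_eval (\<inter>) (O) (\<psi> f) s"
      using eval_image_mono[OF q'(2), of f] by (simp add: \<psi>_def comp_def eq[OF f(1), unfolded \<psi>_def])
    with im[of f] f(2) show False using pinj_fun[OF pinj[OF f(1)]] by blast
  qed
  with q' show "(p, q) \<in> sr_eval (\<inter>) (O) (\<lambda>i. grel h (\<gamma> i)) t" by simp
qed

lemma grels_satisfies:
  assumes B: "sr_satisfies brandt_rels (\<inter>) (O) (s, t)"
    and vars: "card (sr_vars s \<union> sr_vars t) < N"
  shows "sr_satisfies (grels h) (\<inter>) (O) (s, t)"
  unfolding sr_satisfies_def
proof (intro allI impI, unfold fst_conv snd_conv)
  fix \<phi> :: "nat \<Rightarrow> (nat \<times> nat) set" assume "range \<phi> \<subseteq> grels h"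
  then have "\<forall>i. \<exists>g. gwf h g \<and> \<phi> i = grel h g" by (meson grelsE rangeI subsetD)
  then obtain \<gamma> where \<gamma>: "\<And>i. gwf h (\<gamma> i)" "\<And>i. \<phi> i = grel h (\<gamma> i)" by metis
  let ?V = "sr_vars s \<union> sr_vars t"
  \<comment> \<open>Other variables are sent to \<open>Empty\<close>; this extra gadget accounts for
    the strict inequality in \<open>vars\<close>.\<close>
  define \<gamma>' where "\<gamma>' i = (if i \<in> ?V then \<gamma> i else Empty)" for i
  define F where "F = insert Empty (\<gamma> ` ?V)"
  have F: "finite F" "\<forall>g\<in>F. gwf h g" "range \<gamma>' \<subseteq> F"
    using \<gamma>(1) by (auto simp: F_def \<gamma>'_def finite_sr_vars)
  have "card F \<le> Suc (card (\<gamma> ` ?V))" unfolding F_def by (rule card_insert_le_m1) auto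
  also have "\<dots> \<le> Suc (card ?V)" by (simp add: card_image_le finite_sr_vars)
  finally have card: "card F \<le> N" using vars by simp
  have B': "sr_satisfies brandt_rels (\<inter>) (O) (t, s)" using B by (simp add: sr_satisfies_def)
  have "sr_eval (\<inter>) (O) \<phi> s = sr_eval (\<inter>) (O) (\<lambda>i. grel h (\<gamma>' i)) s"
    "sr_eval (\<inter>) (O) \<phi> t = sr_eval (\<inter>) (O) (\<lambda>i. grel h (\<gamma>' i)) t"
    by (auto intro!: sr_eval_cong simp: \<gamma>'_def \<gamma>(2))
  then show "sr_eval (\<inter>) (O) \<phi> s = sr_eval (\<inter>) (O) \<phi> t"
    using gadget_eval_subset[OF B F(1) card F(2,3)] gadget_eval_subset[OF B' F(1) card F(2,3)] by simp
qed

text \<open>The assignment under which the nested word labels the path from left to right.\<close>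

primrec letter_gadget :: "nat \<Rightarrow> nat \<Rightarrow> gadget" where
  "letter_gadget 0 x = Single 0 1"
| "letter_gadget (Suc h) x = Lift (x mod n) (letter_gadget h (x div n))"

lemma gwf_letter_gadget: "gwf h (letter_gadget h x)"
  by (induction h arbitrary: x) (auto simp: len_def)

section \<open>The value of the nested word on its path\<close>

lemma eval_lift:
  assumes "range \<phi> \<subseteq> grels h"
  shows "sr_eval (\<inter>) (O) (\<lambda>x. lift (len h) i (\<phi> x)) t = lift (len h) i (sr_eval (\<inter>) (O) \<phi> t)"
proof (induction t)
  have sub: "sr_eval (\<inter>) (O) \<phi> t \<subseteq> {..len h} \<times> {..len h}" for t
  proof -
    have "sr_eval (\<inter>) (O) \<phi> t \<in> grels h" by (intro sr_eval_closed grels_closed assms)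
    then show ?thesis by (auto elim!: grelsE dest: grel_subset)
  qed
  case (Add s t)
  then show ?case by (simp add: lift_Int[OF sub sub len_pos])
next
  have sub: "sr_eval (\<inter>) (O) \<phi> t \<subseteq> {..len h} \<times> {..len h}" for t
  proof -
    have "sr_eval (\<inter>) (O) \<phi> t \<in> grels h" by (intro sr_eval_closed grels_closed assms)
    then show ?thesis by (auto elim!: grelsE dest: grel_subset)
  qed
  case (Mul s t)
  then show ?case by (simp add: lift_relcomp[OF sub sub len_pos])
qed simp

lemma nested_word_path:
  "(0, len h) \<in> sr_eval (\<inter>) (O) (\<lambda>x. grel h (letter_gadget h x)) (nested_word n v h)"
proof (induction h)
  case (Suc h)
  define W where "W = sr_eval (\<inter>) (O) (\<lambda>x. grel h (letter_gadget h x)) (nested_word n v h)"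
  have W: "(0, len h) \<in> W" using Suc by (simp add: W_def)
  \<comment> \<open>Since \<open>v t < n\<close>, \<open>mod n\<close> recovers the letter
    \<open>v t\<close> of the copy and \<open>div n\<close> the letter \<open>x\<close> inside
    it.\<close>
  have ev: "sr_eval (\<inter>) (O) (\<lambda>x. grel (Suc h) (letter_gadget (Suc h) (n * x + v t))) (nested_word n v h)
      = lift (len h) (v t) W" if "t < 2 * n" for t
    using letter_less[OF that] n_pos unfolding W_def
    by (subst eval_lift[symmetric]) (auto simp: grelsI gwf_letter_gadget)
  have path: "(0, m * len h) \<in> relprod (map (\<lambda>t. lift (len h) (v t) W) [0..<m])" if "m \<le> 2 * n" for m
    using that
  proof (induction m)
    case (Suc m)
    then have "(m * len h + 0, m * len h + len h) \<in> lift (len h) (v m) W"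
      by (intro liftI W) auto
    with Suc show ?case by (auto simp: relprod_append add.commute)
  qed simp
  have "sr_eval (\<inter>) (O) (\<lambda>x. grel (Suc h) (letter_gadget (Suc h) x)) (nested_word n v (Suc h)) =
      relprod (map (\<lambda>t. lift (len h) (v t) W) [0..<2 * n])"
    unfolding eval_nested_word_Suc[OF n_pos]
    by (intro arg_cong[of _ _ relprod] map_cong ev) auto
  with path[of "2 * n"] show ?case by (simp add: len_Suc)
qed (simp add: len_def)

text \<open>The pair \<open>(0, len h)\<close> would factor through some \<open>y\<close>, where
  injectivity forces \<open>y = 0\<close> and functionality forces \<open>y = len h\<close>.\<close>

lemma nested_word_not_idem:
  "\<not> sr_satisfies (grels h) (\<inter>) (O) (Mul (nested_word n v h) (nested_word n v h), nested_word n v h)"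
proof
  let ?\<phi> = "\<lambda>x. grel h (letter_gadget h x)"
  let ?w = "sr_eval (\<inter>) (O) ?\<phi> (nested_word n v h)"
  assume "sr_satisfies (grels h) (\<inter>) (O) (Mul (nested_word n v h) (nested_word n v h), nested_word n v h)"
  moreover have "range ?\<phi> \<subseteq> grels h" by (auto intro: grelsI gwf_letter_gadget)
  ultimately have idem: "?w O ?w = ?w" by (simp add: sr_satisfies_def)
  have pinj: "pinj ?w" by (intro pinj_eval pinj_grel gwf_letter_gadget)
  from idem nested_word_path[of h] obtain y where y: "(0, y) \<in> ?w" "(y, len h) \<in> ?w" by blast
  with nested_word_path[of h] have "y = 0" by (blast intro: pinj_inj[OF pinj])
  moreover have "y = len h" using y nested_word_path[of h] by (blast intro: pinj_fun[OF pinj])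
  ultimately show False using len_pos[of h] by simp
qed

end

section \<open>A sufficiently irregular word\<close>

text \<open>The word \<open>0, 1, 2, \<dots>, 2m, 0, 2, 4, \<dots>, 2m, 1, 3, \<dots>, 2m - 1\<close>.\<close>

definition shuffle_word :: "nat \<Rightarrow> nat \<Rightarrow> nat" where
  "shuffle_word m t = (if t \<le> 2 * m then t
     else if t \<le> 3 * m + 1 then 2 * (t - (2 * m + 1)) else 2 * (t - (2 * m + 1)) - (2 * m + 1))"

text \<open>Free of subtraction, so that later claims reduce to linear arithmetic on the three runs
  of the word.\<close>

lemma shuffle_word_cases:
  assumes "t < 2 * (2 * m + 1)"
  shows "t \<le> 2 * m \<and> shuffle_word m t = t \<or>
    2 * m < t \<and> t \<le> 3 * m + 1 \<and> shuffle_word m t + 4 * m + 2 = 2 * t \<or>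
    3 * m + 1 < t \<and> t \<le> 4 * m + 1 \<and> shuffle_word m t + 6 * m + 3 = 2 * t"
  using assms by (auto simp: shuffle_word_def)

text \<open>The second half is doubling modulo the odd number \<open>2 * m + 1\<close>.\<close>

lemma shuffle_word_inj:
  "inj_on (shuffle_word m) {0..<2 * m + 1}"
  "inj_on (shuffle_word m) {2 * m + 1..<2 * (2 * m + 1)}"
proof -
  show "inj_on (shuffle_word m) {0..<2 * m + 1}" by (rule inj_onI) (auto simp: shuffle_word_def)
  show "inj_on (shuffle_word m) {2 * m + 1..<2 * (2 * m + 1)}"
  proof (rule inj_onI)
    fix t s assume "t \<in> {2 * m + 1..<2 * (2 * m + 1)}" "s \<in> {2 * m + 1..<2 * (2 * m + 1)}"
      and eq: "shuffle_word m t = shuffle_word m s"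
    then have "2 * m < t" "2 * m < s" and "t < 2 * (2 * m + 1)" "s < 2 * (2 * m + 1)" by auto
    with shuffle_word_cases[OF this(3)] shuffle_word_cases[OF this(4)] eq show "t = s"
      by (elim disjE) (linarith | presburger)+
  qed
qed

lemma mset_shuffle_word:
  fixes m n :: nat
  defines "n \<equiv> 2 * m + 1"
  shows "mset (map (shuffle_word m) [0..<n]) = mset (map (shuffle_word m) [n..<2 * n])"
proof -
  note inj = shuffle_word_inj(2)[of m, folded n_def]
  have "shuffle_word m t < n" if "t < 2 * n" for t
    using shuffle_word_cases[of t m] that unfolding n_def by linarith
  then have sub: "shuffle_word m ` {n..<2 * n} \<subseteq> {0..<n}" by auto
  have "card (shuffle_word m ` {n..<2 * n}) = card {0..<n}" using card_image[OF inj] by simp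
  then have "shuffle_word m ` {n..<2 * n} = {0..<n}" using sub by (intro card_subset_eq) auto
  moreover have "map (shuffle_word m) [0..<n] = [0..<n]"
    by (intro map_idI) (auto simp: shuffle_word_def n_def)
  ultimately show ?thesis
    using inj by (subst set_eq_iff_mset_eq_distinct[symmetric]) (auto simp: distinct_map)
qed

text \<open>Each half contains every letter once, so a window over \<open>N\<close> letters has at
  most \<open>N\<close> positions in each half.\<close>

lemma shuffle_word_window:
  assumes "finite I" "card I \<le> N" "s < 2 * (2 * m + 1)" "shuffle_word m ` {t..s} \<subseteq> I"
  shows "s - t \<le> 2 * N"
proof -
  have card: "card ({t..s} \<inter> A) \<le> N" if "inj_on (shuffle_word m) A" for A
  proof -
    have "card ({t..s} \<inter> A) = card (shuffle_word m ` ({t..s} \<inter> A))"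
      by (rule card_image[symmetric]) (rule inj_on_subset[OF that], blast)
    also have "\<dots> \<le> card I" by (rule card_mono[OF assms(1)]) (use assms(4) in blast)
    finally show ?thesis using assms(2) by simp
  qed
  have "{t..s} = ({t..s} \<inter> {0..<2 * m + 1}) \<union> ({t..s} \<inter> {2 * m + 1..<2 * (2 * m + 1)})"
    using assms(3) by auto
  then have "card {t..s} \<le> card ({t..s} \<inter> {0..<2 * m + 1}) + card ({t..s} \<inter> {2 * m + 1..<2 * (2 * m + 1)})"
    by (metis card_Un_le)
  with card[OF shuffle_word_inj(1)] card[OF shuffle_word_inj(2)] show ?thesis by simp
qed

text \<open>The two occurrences of a letter are more than \<open>m\<close> positions apart.\<close>

lemma shuffle_word_no_repeat:
  assumes "t < s" "s \<le> t + 2 * N" "s < 2 * (2 * m + 1)" "2 * N \<le> m"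
  shows "shuffle_word m t \<noteq> shuffle_word m s"
proof
  assume eq: "shuffle_word m t = shuffle_word m s"
  have t: "t < 2 * (2 * m + 1)" using assms by simp
  from shuffle_word_cases[OF t] shuffle_word_cases[OF assms(3)] eq assms show False
    by (elim disjE) (linarith | presburger)+
qed

lemma shuffle_word_low: "t \<le> 2 * m \<Longrightarrow> shuffle_word m t = t"
  by (simp add: shuffle_word_def)

lemma shuffle_word_high:
  assumes "2 * m < t" "t < 2 * (2 * m + 1)"
  shows "t \<le> 3 * m + 1 \<and> shuffle_word m t + 4 * m + 2 = 2 * t \<or>
    3 * m + 1 < t \<and> shuffle_word m t + 6 * m + 3 = 2 * t"
  using shuffle_word_cases[OF assms(2)] assms(1) by (elim disjE) linarith+

text \<open>The two occurrences of each letter must lie in different halves, for otherwise the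
  windows would join to one of length at most \<open>4 * N\<close> with a repeated letter. This
  leaves two windows across the middle, or one window in each half.\<close>

lemma shuffle_word_no_swap:
  assumes "t < s" "s \<le> t + 2 * N" "s < 2 * (2 * m + 1)" "t' < s'" "s' \<le> t' + 2 * N"
    "s' < 2 * (2 * m + 1)" "10 * N + 10 \<le> m" "shuffle_word m t = shuffle_word m s'"
  shows "shuffle_word m s \<noteq> shuffle_word m t'"
proof
  assume eq: "shuffle_word m s = shuffle_word m t'"
  have less: "t < 2 * (2 * m + 1)" "t' < 2 * (2 * m + 1)" using assms by auto
  have same: "x = y" if "x \<le> 2 * m \<longleftrightarrow> y \<le> 2 * m" "x < 2 * (2 * m + 1)" "y < 2 * (2 * m + 1)"
    "shuffle_word m x = shuffle_word m y" for x y
    using that shuffle_word_low[of x m] shuffle_word_low[of y m] inj_onD[OF shuffle_word_inj(2), of m x y]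
    by (cases "x \<le> 2 * m") auto
  have "t \<noteq> s'"
  proof
    assume "t = s'"
    then have "t' < s" "s \<le> t' + 2 * (2 * N)" using assms by auto
    from shuffle_word_no_repeat[OF this assms(3)] eq assms(7) show False by simp
  qed
  then have 1: "\<not> (t \<le> 2 * m \<longleftrightarrow> s' \<le> 2 * m)" using same[OF _ less(1) assms(6,8)] by blast
  have "s \<noteq> t'"
  proof
    assume "s = t'"
    then have "t < s'" "s' \<le> t + 2 * (2 * N)" using assms by auto
    from shuffle_word_no_repeat[OF this assms(6)] assms(7,8) show False by simp
  qed
  then have 2: "\<not> (s \<le> 2 * m \<longleftrightarrow> t' \<le> 2 * m)" using same[OF _ assms(3) less(2) eq] by blast
  \<comment> \<open>Just before the middle the letters are close to \<open>2 * m\<close>, just after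
    it they are small.\<close>
  have swap: False if "x \<le> 2 * m" "2 * m < y" "x' \<le> 2 * m" "2 * m < y'" "y \<le> x + 2 * N" "y' \<le> x' + 2 * N"
    "y < 2 * (2 * m + 1)" "y' < 2 * (2 * m + 1)" "shuffle_word m x = shuffle_word m y'"
    "shuffle_word m y = shuffle_word m x'" for x y x' y'
    using shuffle_word_high[OF that(2,7)] shuffle_word_high[OF that(4,8)]
      shuffle_word_low[OF that(1)] shuffle_word_low[OF that(3)] that assms(7)
    by (elim disjE conjE) linarith+
  \<comment> \<open>In the second half nearby letters increase, except at the passage from even to
    odd, where the drop is far larger than \<open>2 * N\<close>.\<close>
  have rev: False if "x < y" "y \<le> 2 * m" "2 * m < x'" "x' < y'" "y \<le> x + 2 * N" "y' \<le> x' + 2 * N"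
    "y' < 2 * (2 * m + 1)" "shuffle_word m x = shuffle_word m y'"
    "shuffle_word m y = shuffle_word m x'" for x y x' y'
  proof -
    have x: "x \<le> 2 * m" "x' < 2 * (2 * m + 1)" "2 * m < y'" using that by auto
    show False
      using shuffle_word_high[OF that(3) x(2)] shuffle_word_high[OF x(3) that(7)]
        shuffle_word_low[OF that(2)] shuffle_word_low[OF x(1)] that assms(7)
      by (elim disjE conjE) linarith+
  qed
  consider "t \<le> 2 * m" "2 * m < s'" "s \<le> 2 * m" "2 * m < t'" | "t \<le> 2 * m" "2 * m < s'" "2 * m < s" "t' \<le> 2 * m"
    | "2 * m < t" "s' \<le> 2 * m" "2 * m < s" "t' \<le> 2 * m"
    using 1 2 assms(1,4) by linarith
  then show False
  proof cases
    case 1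
    with rev[of t s t' s'] assms eq show False by simp
  next
    case 2
    with swap[of t s t' s'] assms eq show False by simp
  next
    case 3
    with rev[of t' s' t s] assms eq show False by simp
  qed
qed

text \<open>Consecutive letters grow by one in the first half and by two in the second; the
  exceptional factors are \<open>2m, 0\<close> at the middle and \<open>2m, 1\<close> between even
  and odd letters.\<close>

lemma shuffle_word_factor_unique:
  assumes "Suc t < 2 * (2 * m + 1)" "Suc s < 2 * (2 * m + 1)" "m \<ge> 10"
    "shuffle_word m t = shuffle_word m s" "shuffle_word m (Suc t) = shuffle_word m (Suc s)"
  shows "t = s"
proof -
  have le: "t \<ge> s" if t: "t1 = t + 1" "s1 = s + 1" "t1 < 2 * (2 * m + 1)" "s1 < 2 * (2 * m + 1)"
    and eq: "shuffle_word m t = shuffle_word m s" "shuffle_word m t1 = shuffle_word m s1" for t s t1 s1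
  proof (rule ccontr)
    assume "\<not> t \<ge> s"
    then have "t < s" by simp
    have s: "2 * m < s" using shuffle_word_low[of t m] shuffle_word_low[of s m] eq(1) \<open>t < s\<close> by linarith
    have "t \<le> 2 * m"
      using inj_onD[OF shuffle_word_inj(2) eq(1)] t \<open>t < s\<close> by (force simp: not_le)
    have "s < 2 * (2 * m + 1)" "2 * m < s1" using t s by auto
    note h = shuffle_word_high[OF s this(1)] shuffle_word_high[OF this(2) t(4)]
      shuffle_word_low[OF \<open>t \<le> 2 * m\<close>]
    show False
    proof (cases "t1 \<le> 2 * m")
      case True
      from h shuffle_word_low[OF True] eq t(1,2) assms(3) show False by (elim disjE conjE) linarith+
    next
      case False
      then have "t = 2 * m" using \<open>t \<le> 2 * m\<close> t by simp
      moreover from this have "shuffle_word m t1 = 0" using t by (simp add: shuffle_word_def)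
      ultimately show False using h eq t(1,2) assms(3) by (elim disjE conjE) linarith+
    qed
  qed
  from le[of "Suc t" t "Suc s" s] le[of "Suc s" s "Suc t" t] assms show ?thesis by simp
qed

lemma sparse_word_shuffle_word:
  assumes "N \<ge> 2" "10 * N + 10 \<le> m"
  shows "sparse_word (2 * m + 1) N (shuffle_word m)"
proof
  show "shuffle_word m t < 2 * m + 1" if "t < 2 * (2 * m + 1)" for t
    using that by (auto simp: shuffle_word_def)
  show "t = s" if "Suc t < 2 * (2 * m + 1)" "Suc s < 2 * (2 * m + 1)"
    "shuffle_word m t = shuffle_word m s" "shuffle_word m (Suc t) = shuffle_word m (Suc s)" for t s
    using shuffle_word_factor_unique[OF that(1,2) _ that(3,4)] assms by simp
next
  fix I :: "nat set" and t s
  assume I: "finite I" "card I \<le> N" and ts: "t < s" "s < 2 * (2 * m + 1)" "shuffle_word m ` {t..s} \<subseteq> I"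
  have *: "s \<le> t + 2 * N" using shuffle_word_window[OF I ts(2,3)] by simp
  then show "shuffle_word m t \<noteq> shuffle_word m s"
    using shuffle_word_no_repeat[OF ts(1) * ts(2)] assms by simp
  fix t' s'
  assume ts': "t' < s'" "s' < 2 * (2 * m + 1)" "shuffle_word m ` {t'..s'} \<subseteq> I" "shuffle_word m t = shuffle_word m s'"
  have "s' \<le> t' + 2 * N" using shuffle_word_window[OF I ts'(2,3)] by simp
  then show "shuffle_word m s \<noteq> shuffle_word m t'"
    using shuffle_word_no_swap[OF ts(1) * ts(2) ts'(1) _ ts'(2) assms(2) ts'(4)] by simp
qed (use assms in auto)

section \<open>The finite basis problem\<close>

context inverse_semigroup
begin

section \<open>Natural addition as intersection under the representation\<close>

lemma rep_pow_exponent: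
  assumes fin: "finite S" and comb: "combinatorial S mul"
  obtains k where "\<And>x. x \<in> S \<Longrightarrow> rep x ^^ Suc (Suc k) \<subseteq> Id \<inter> rep x"
proof -
  have ev: "eventually (\<lambda>k. rep x ^^ Suc k \<subseteq> Id \<inter> rep x) sequentially" if x: "x \<in> S" for x
  proof (rule eventually_relpow_subset)
    show "finite (rep x)" using rep_subset[OF x] fin by (meson finite_SigmaI finite_subset)
    fix k assume eq: "Domain (rep x ^^ Suc k) = Range (rep x ^^ Suc k)"
    have "\<exists>y\<in>S. rep y = rep x ^^ Suc k"
    proof (induction k)
      case (Suc k)
      then obtain y where "y \<in> S" "rep y = rep x ^^ Suc k" by blast
      then show ?case using x by (intro bexI[of _ "mul y x"]) (auto simp: rep_mul mul_closed)
    qed (use x in auto)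
    with rep_combinatorial[OF comb] eq show "rep x ^^ Suc k \<subseteq> Id" by metis
  qed (rule pinj_rep[OF x])
  have "eventually (\<lambda>k. \<forall>x\<in>S. rep x ^^ Suc k \<subseteq> Id \<inter> rep x) sequentially"
    using ev by (intro eventually_ball_finite fin) blast
  then obtain K where K: "\<forall>k\<ge>K. \<forall>x\<in>S. rep x ^^ Suc k \<subseteq> Id \<inter> rep x"
    unfolding eventually_sequentially by (rule exE)
  \<comment> \<open>Going one beyond \<open>K\<close> makes the exponent a successor, as the Brandt
    monoid requires.\<close>
  show ?thesis by (rule that[of K], rule K[rule_format]) simp_all
qed

lemma pinj_representation_rep:
  assumes "\<And>x. x \<in> S \<Longrightarrow> rep x ^^ Suc k \<subseteq> Id \<inter> rep x"
  shows "pinj_representation S mul invs rep k"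
  by standard (use assms in \<open>auto simp: mul_closed inv_closed rep_mul rep_converse pinj_rep simp del: relpow.simps\<close>)

text \<open>The intersection is represented by an element \<open>z\<close> of \<open>S\<close>, the
  value of an inverse semigroup term. As the natural order is inclusion, \<open>z\<close> is the
  infimum, and by \<open>rep_inject\<close> the only one, so the choice in \<open>meet\<close>
  returns it.\<close>

lemma nat_add_rep:
  assumes "pinj_representation S mul invs rep k" and x: "x \<in> S" and y: "y \<in> S"
  shows "nat_add S mul invs x y \<in> S \<and> rep (nat_add S mul invs x y) = rep x \<inter> rep y"
proof -
  interpret pinj_representation S mul invs rep k by fact
  define \<phi> where "\<phi> i = (if i = 0 then x else y)" for i :: nat
  obtain z where z: "z \<in> S" "rep z = rep x \<inter> rep y"
    using eval_inv_of_sr[of \<phi> "Add (Var 0) (Var 1)"] x y by (auto simp: \<phi>_def)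
  let ?L = "nat_order S mul invs"
  have le: "le ?L u w \<longleftrightarrow> rep u \<subseteq> rep w" if "u \<in> S" "w \<in> S" for u w
    using rep_subset_iff[OF that] by (simp add: nat_order_def)
  have carrier: "carrier ?L = S" by (simp add: nat_order_def)
  have Lower: "u \<in> Lower ?L {x, y} \<longleftrightarrow> u \<in> S \<and> rep u \<subseteq> rep z" for u
    using x y le[of u x] le[of u y] unfolding Lower_def carrier z(2) by (cases "u \<in> S") auto
  have glb: "greatest ?L w (Lower ?L {x, y}) \<longleftrightarrow>
      w \<in> S \<and> rep w \<subseteq> rep z \<and> (\<forall>u\<in>S. rep u \<subseteq> rep z \<longrightarrow> rep u \<subseteq> rep w)" for w
    unfolding greatest_def subset_iff[of "Lower ?L {x, y}"] Ball_def Lower carrier using le by blast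
  have z_glb: "greatest ?L z (Lower ?L {x, y})" unfolding glb using z(1) by blast
  have "w = z" if "greatest ?L w (Lower ?L {x, y})" for w
  proof -
    have w: "w \<in> S" "rep w = rep z" using that z(1) unfolding glb by blast+
    show ?thesis by (rule rep_inject[OF w(1) z(1) w(2)])
  qed
  with z_glb have "nat_add S mul invs x y = z"
    unfolding nat_add_def meet_def inf_def by (intro some_equality)
  with z show ?thesis by simp
qed

lemma eval_rep:
  assumes "pinj_representation S mul invs rep k" and "range \<phi> \<subseteq> S"
  shows "sr_eval (nat_add S mul invs) mul \<phi> t \<in> S \<and>
    rep (sr_eval (nat_add S mul invs) mul \<phi> t) = sr_eval (\<inter>) (O) (rep \<circ> \<phi>) t"
  by (induction t) (use assms(2) in \<open>auto simp: nat_add_rep[OF assms(1)] mul_closed rep_mul\<close>)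

lemma aperiodic_rels_rep:
  assumes "finite S" "combinatorial S mul"
  shows "aperiodic_rels S (rep ` S)"
proof
  fix R R' assume "R \<in> rep ` S" "R' \<in> rep ` S"
  then show "R O R' \<in> rep ` S" by (auto simp: mul_closed simp flip: rep_mul)
next
  fix R assume "R \<in> rep ` S"
  then show "R \<subseteq> S \<times> S" "pinj R" "Domain R = Range R \<Longrightarrow> R \<subseteq> Id"
    using rep_subset pinj_rep rep_combinatorial[OF assms(2)] by blast+
qed (rule assms(1))

end

theorem theorem1p2:
  fixes S :: "'a set" and mul :: "'a \<Rightarrow> 'a \<Rightarrow> 'a" and invs :: "'a \<Rightarrow> 'a"
  assumes "inverse_semigroup S mul invs"
    and "finite S"
    and "combinatorial S mul"
    and "\<forall>e. inv_satisfies S mul invs e \<longrightarrow> inv_satisfies brandt_monoid (**) transpose e"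
  shows "\<not> (\<exists>\<Sigma>. finite \<Sigma> \<and> identity_basis S (nat_add S mul invs) mul \<Sigma>)"
proof
  interpret inverse_semigroup S mul invs by fact
  let ?add = "nat_add S mul invs"
  assume "\<exists>\<Sigma>. finite \<Sigma> \<and> identity_basis S ?add mul \<Sigma>"
  then obtain \<Sigma> where \<Sigma>: "finite \<Sigma>" "\<And>s t. (s, t) \<in> \<Sigma> \<Longrightarrow> sr_satisfies S ?add mul (s, t)"
    "\<And>s t. sr_satisfies S ?add mul (s, t) \<Longrightarrow> follows \<Sigma> s t"
    unfolding identity_basis_def by blast
  obtain k where k: "\<And>x. x \<in> S \<Longrightarrow> rep x ^^ Suc (Suc k) \<subseteq> Id \<inter> rep x"
    using rep_pow_exponent[OF assms(2,3)] by blast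
  have R: "pinj_representation S mul invs rep (Suc k)" by (rule pinj_representation_rep[OF k])
  interpret R: pinj_representation S mul invs rep "Suc k" by (rule R)
  \<comment> \<open>Both sides are translated into inverse semigroup terms, to which the hypothesis
    on the Brandt monoid applies.\<close>
  have brandt: "sr_satisfies brandt_rels (\<inter>) (O) (s, t)" if st: "sr_satisfies S ?add mul (s, t)" for s t
  proof -
    have "inv_satisfies S mul invs (inv_of_sr (Suc k) s, inv_of_sr (Suc k) t)"
      unfolding inv_satisfies_def
    proof (intro allI impI, unfold fst_conv snd_conv, rule rep_inject)
      fix \<phi> :: "nat \<Rightarrow> 'a" assume \<phi>: "range \<phi> \<subseteq> S"
      show "inv_eval mul invs \<phi> (inv_of_sr (Suc k) s) \<in> S" "inv_eval mul invs \<phi> (inv_of_sr (Suc k) t) \<in> S"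
        using R.eval_inv_of_sr[OF \<phi>] by auto
      have "sr_eval (\<inter>) (O) (rep \<circ> \<phi>) s = sr_eval (\<inter>) (O) (rep \<circ> \<phi>) t"
        using st \<phi> eval_rep[OF R \<phi>, of s] eval_rep[OF R \<phi>, of t] by (simp add: sr_satisfies_def)
      then show "rep (inv_eval mul invs \<phi> (inv_of_sr (Suc k) s)) = rep (inv_eval mul invs \<phi> (inv_of_sr (Suc k) t))"
        using R.eval_inv_of_sr[OF \<phi>] by simp
    qed
    with assms(4) show ?thesis by (intro brandt_rels_satisfies) blast
  qed
  \<comment> \<open>\<open>N\<close> exceeds the number of variables of every identity in
    \<open>\<Sigma>\<close>; the second successor ensures \<open>N \<ge> 2\<close>.\<close>
  define N where "N = Suc (Suc (\<Sum>(s, t)\<in>\<Sigma>. card (sr_vars s \<union> sr_vars t)))"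
  define m where "m = 10 * N + 10"
  define n where "n = 2 * m + 1"
  define v where "v = shuffle_word m"
  \<comment> \<open>The height is \<open>card S\<close> because the representing relations act on
    \<open>S\<close>.\<close>
  define w where "w = nested_word n v (card S)"
  interpret sparse_word n N v
    unfolding n_def v_def by (rule sparse_word_shuffle_word) (auto simp: N_def m_def)
  have "sr_satisfies (grels (card S)) (\<inter>) (O) (s, t)" if "(s, t) \<in> \<Sigma>" for s t
  proof (rule grels_satisfies)
    show "sr_satisfies brandt_rels (\<inter>) (O) (s, t)" using brandt \<Sigma>(2) that by blast
    show "card (sr_vars s \<union> sr_vars t) < N"
      using member_le_sum[OF that, of "\<lambda>(s, t). card (sr_vars s \<union> sr_vars t)"] \<Sigma>(1) by (simp add: N_def)
  qed
  then have grels_\<Sigma>: "\<forall>e\<in>\<Sigma>. sr_satisfies (grels (card S)) (\<inter>) (O) e" by auto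
  have "sr_satisfies S ?add mul (Mul w w, w)"
    unfolding sr_satisfies_def
  proof (intro allI impI, unfold fst_conv snd_conv, rule rep_inject)
    fix \<phi> :: "nat \<Rightarrow> 'a" assume \<phi>: "range \<phi> \<subseteq> S"
    interpret aperiodic_rels S "rep ` S" by (rule aperiodic_rels_rep[OF assms(2,3)])
    have "sr_eval (\<inter>) (O) (rep \<circ> \<phi>) w \<subseteq> Id"
      unfolding w_def
    proof (rule nested_word_idem)
      show "mset (map v [0..<n]) = mset (map v [n..<2 * n])"
        unfolding n_def v_def by (rule mset_shuffle_word)
    qed (use \<phi> n_pos in auto)
    then have "sr_eval (\<inter>) (O) (rep \<circ> \<phi>) w O sr_eval (\<inter>) (O) (rep \<circ> \<phi>) w = sr_eval (\<inter>) (O) (rep \<circ> \<phi>) w"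
      by blast
    then show "rep (sr_eval ?add mul \<phi> (Mul w w)) = rep (sr_eval ?add mul \<phi> w)"
      using eval_rep[OF R \<phi>, of "Mul w w"] eval_rep[OF R \<phi>, of w] by simp
    show "sr_eval ?add mul \<phi> (Mul w w) \<in> S" "sr_eval ?add mul \<phi> w \<in> S"
      using eval_rep[OF R \<phi>] by blast+
  qed
  \<comment> \<open>Derivability carries \<open>w w = w\<close> over to
    \<open>grels (card S)\<close>, where it fails.\<close>
  then have "follows \<Sigma> (Mul w w) w" by (rule \<Sigma>(3))
  then have "sr_satisfies (grels (card S)) (\<inter>) (O) (Mul w w, w)"
    by (rule follows_sound[OF _ grels_closed grels_\<Sigma>])
  then show False unfolding w_def using nested_word_not_idem by blast
qed

end
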